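(* Let $k$ be a field whose characteristic is not $2$ and let $A$ be a smooth finite type commutative $k$-algebra. Then the Lie algebra $\mathfrak{g}:=\mathrm{Der}_k(A)$ (with the commutator bracket) is finitely generated as a Lie algebra over $k$.
   Context: $\mathrm{Der}_k(A)$ is the $k$-Lie algebra of $k$-linear derivations $A\to A$. *)

theory Defs
  imports "HOL-Algebra.Algebra"
begin

section \<open>Commutative algebras\<close>

text \<open>
  A commutative, associative, unital algebra over \<open>K\<close> is an instance of the library locale
  \<^locale>\<open>algebra\<close>; the zero ring is allowed.
\<close>

text \<open>
  The additive order of an element of infinite order is \<open>0\<close>, so this is the usual characteristic.
\<close>

definition ring_characteristic :: "('k, 'n) ring_scheme \<Rightarrow> nat" where
  "ring_characteristic R = group.ord (add_monoid R) \<one>\<^bsub>R\<^esub>"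

lemma (in ring) ring_characteristic_iff:
  "add_pow R n \<one> = \<zero> \<longleftrightarrow> ring_characteristic R dvd n" for n :: nat
  using add.pow_eq_id[of \<one> n] by (simp add: ring_characteristic_def)

definition unital_subalgebra ::
  "('k, 'n) ring_scheme \<Rightarrow> ('k, 'a, 'm) module_scheme \<Rightarrow> 'a set \<Rightarrow> bool" where
  "unital_subalgebra K A B \<longleftrightarrow>
     subring B A \<and> (\<forall>c\<in>carrier K. \<forall>b\<in>B. c \<odot>\<^bsub>A\<^esub> b \<in> B)"

definition finite_type_algebra ::
  "('k, 'n) ring_scheme \<Rightarrow> ('k, 'a, 'm) module_scheme \<Rightarrow> bool" where
  "finite_type_algebra K A \<longleftrightarrow>
     (\<exists>S. finite S \<and> S \<subseteq> carrier A \<and> unital_subalgebra K A hull S = carrier A)"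

definition algebra_hom ::
  "('k, 'n) ring_scheme \<Rightarrow> ('k, 'a, 'm) module_scheme \<Rightarrow> ('k, 'b, 'l) module_scheme \<Rightarrow> ('a \<Rightarrow> 'b) set"
  where
  "algebra_hom K A B =
     {h \<in> ring_hom A B. \<forall>c\<in>carrier K. \<forall>a\<in>carrier A. h (c \<odot>\<^bsub>A\<^esub> a) = c \<odot>\<^bsub>B\<^esub> h a}"

definition quot_algebra :: "('k, 'a, 'm) module_scheme \<Rightarrow> 'a set \<Rightarrow> ('k, 'a set) module" where
  "quot_algebra R I =
     ring.extend (R Quot I) (module.fields (\<lambda>c Y. \<Union>x\<in>Y. I +>\<^bsub>R\<^esub> (c \<odot>\<^bsub>R\<^esub> x)))"

lemma quot_algebra_simps [simp]:
  "carrier (quot_algebra R I) = carrier (R Quot I)"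
  "monoid.mult (quot_algebra R I) = monoid.mult (R Quot I)"
  "monoid.one (quot_algebra R I) = monoid.one (R Quot I)"
  "ring.zero (quot_algebra R I) = ring.zero (R Quot I)"
  "ring.add (quot_algebra R I) = ring.add (R Quot I)"
  "smult (quot_algebra R I) = (\<lambda>c Y. \<Union>x\<in>Y. I +>\<^bsub>R\<^esub> (c \<odot>\<^bsub>R\<^esub> x))"
  by (simp_all add: quot_algebra_def ring.defs module.defs)

lemma quot_algebra_smult:
  assumes "algebra K R" "ideal I R" "c \<in> carrier K" "x \<in> carrier R"
  shows "c \<odot>\<^bsub>quot_algebra R I\<^esub> (I +>\<^bsub>R\<^esub> x) = I +>\<^bsub>R\<^esub> (c \<odot>\<^bsub>R\<^esub> x)"
proof -
  interpret A: cring R by (rule algebra.M_cring[OF assms(1)])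
  interpret algebra K R by fact
  interpret I: ideal I R by fact
  have const: "I +>\<^bsub>R\<^esub> (c \<odot>\<^bsub>R\<^esub> y) = I +>\<^bsub>R\<^esub> (c \<odot>\<^bsub>R\<^esub> x)" if y: "y \<in> I +>\<^bsub>R\<^esub> x" for y
  proof -
    obtain i where i: "i \<in> I" "y = i \<oplus>\<^bsub>R\<^esub> x"
      using y by (auto simp: a_r_coset_def')
    have iR: "i \<in> carrier R" using i I.Icarr by blast
    have "c \<odot>\<^bsub>R\<^esub> i = (c \<odot>\<^bsub>R\<^esub> \<one>\<^bsub>R\<^esub>) \<otimes>\<^bsub>R\<^esub> i"
      using assms iR by (simp add: smult_assoc2)
    then have ci: "c \<odot>\<^bsub>R\<^esub> i \<in> I"
      using i I.I_l_closed assms by simp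
    have "c \<odot>\<^bsub>R\<^esub> y = c \<odot>\<^bsub>R\<^esub> i \<oplus>\<^bsub>R\<^esub> c \<odot>\<^bsub>R\<^esub> x"
      using i iR assms by (simp add: smult_r_distr)
    then have "c \<odot>\<^bsub>R\<^esub> y \<in> I +>\<^bsub>R\<^esub> (c \<odot>\<^bsub>R\<^esub> x)"
      using ci by (auto simp: a_r_coset_def')
    then show ?thesis
      using I.a_repr_independence' assms by (metis smult_closed)
  qed
  have "x \<in> I +>\<^bsub>R\<^esub> x"
    using I.a_rcos_self assms by blast
  then show ?thesis
    unfolding quot_algebra_simps using const by blast
qed

lemma quot_algebra_is_algebra:
  assumes "algebra K R" "ideal I R"
  shows "algebra K (quot_algebra R I)"
proof -
  interpret A: cring R by (rule algebra.M_cring[OF assms(1)])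
  interpret algebra K R by fact
  interpret I: ideal I R by fact
  interpret Q: cring "R Quot I"
    using I.quotient_is_cring A.is_cring by blast
  have Q: "cring (quot_algebra R I)"
  proof (rule cringI)
    show "abelian_group (quot_algebra R I)"
      by (rule abelian_groupI) (simp_all add: Q.a_ac)
    show "comm_monoid (quot_algebra R I)"
      by (rule comm_monoidI) (simp_all add: Q.m_ac)
  qed (simp add: Q.l_distr)
  have mem: "\<exists>x\<in>carrier R. Y = I +>\<^bsub>R\<^esub> x" if "Y \<in> carrier (R Quot I)" for Y
    using that by (auto simp: FactRing_def A_RCOSETS_def')
  have car: "I +>\<^bsub>R\<^esub> x \<in> carrier (R Quot I)" if "x \<in> carrier R" for x
    using that by (auto simp: FactRing_def A_RCOSETS_def')
  have add: "(I +>\<^bsub>R\<^esub> x) \<oplus>\<^bsub>R Quot I\<^esub> (I +>\<^bsub>R\<^esub> y) = I +>\<^bsub>R\<^esub> (x \<oplus>\<^bsub>R\<^esub> y)"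
    if "x \<in> carrier R" "y \<in> carrier R" for x y
    using that I.a_rcos_sum by (simp add: FactRing_def)
  have mult: "(I +>\<^bsub>R\<^esub> x) \<otimes>\<^bsub>R Quot I\<^esub> (I +>\<^bsub>R\<^esub> y) = I +>\<^bsub>R\<^esub> (x \<otimes>\<^bsub>R\<^esub> y)"
    if "x \<in> carrier R" "y \<in> carrier R" for x y
    using that I.rcoset_mult_add by (simp add: FactRing_def)
  note sm = quot_algebra_smult[OF assms]
  note [simp del] = quot_algebra_simps(6)
  show ?thesis
  proof (rule algebraI[OF R_cring Q], goal_cases)
    case (1 c Y)
    then show ?case using mem[of Y] by (force simp: sm car)
  next
    case (2 c d Y)
    then show ?case using mem[of Y] by (force simp: sm add smult_l_distr)
  next
    case (3 c Y Z)
    then show ?case using mem[of Y] mem[of Z] by (force simp: sm add smult_r_distr)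
  next
    case (4 c d Y)
    then show ?case using mem[of Y] by (force simp: sm smult_assoc1)
  next
    case (5 Y)
    then show ?case using mem[of Y] by (force simp: sm)
  next
    case (6 c Y Z)
    then show ?case using mem[of Y] mem[of Z] by (force simp: sm mult smult_assoc2)
  qed
qed


section \<open>Smoothness\<close>

text \<open>
  Infinitesimal lifting: every \<open>K\<close>-algebra map \<open>A \<rightarrow> R/I\<close> with \<open>I\<^sup>2 = 0\<close> lifts to \<open>A \<rightarrow> R\<close>.
  HOL cannot quantify over all types, so the type \<open>'r\<close> of elements of \<open>R\<close> is a parameter.
\<close>

definition formally_smooth ::
  "'r itself \<Rightarrow> ('k, 'n) ring_scheme \<Rightarrow> ('k, 'a, 'm) module_scheme \<Rightarrow> bool" where
  "formally_smooth (_ :: 'r itself) K A \<longleftrightarrow>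
     (\<forall>(R :: ('k, 'r) module) I u.
        algebra K R \<and> ideal I R \<and> ideal_prod R I I = {\<zero>\<^bsub>R\<^esub>} \<and>
        u \<in> algebra_hom K A (quot_algebra R I) \<longrightarrow>
        (\<exists>v\<in>algebra_hom K A R. \<forall>a\<in>carrier A. I +>\<^bsub>R\<^esub> v a = u a))"

text \<open>
  Smooth means formally smooth and of finite presentation; \<open>K\<close> will be a field, so finite
  presentation is the same as finite type. For \<open>A\<close> of finite type it is enough to test lifting
  against \<open>R\<close> of finite type: replace \<open>R\<close> by the subalgebra \<open>R\<^sub>0\<close> generated by lifts to \<open>R\<close> of
  the images under \<open>u\<close> of finitely many generators of \<open>A\<close>, and \<open>I\<close> by \<open>I \<inter> R\<^sub>0\<close>. Every algebra
  of finite type is isomorphic to a quotient of a polynomial ring in variables indexed by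
  \<^typ>\<open>nat\<close>. Polynomials are coefficient functions on monomials, that is on finite multisets of
  variables, and elements of a quotient are cosets, i.e. sets of polynomials. Hence the type chosen
  below contains a copy of every \<open>R\<close> that matters, and the restriction to it is immaterial.
\<close>

definition smooth_algebra ::
  "('k, 'n) ring_scheme \<Rightarrow> ('k, 'a, 'm) module_scheme \<Rightarrow> bool" where
  "smooth_algebra K A \<longleftrightarrow>
     finite_type_algebra K A \<and> formally_smooth TYPE((nat multiset \<Rightarrow> 'k) set) K A"


section \<open>Lie algebras\<close>

text \<open>As usual for modules, the ring fields \<^const>\<open>monoid.mult\<close> and \<^const>\<open>monoid.one\<close> carry no meaning.\<close>

record ('k, 'l) lie_module = "('k, 'l) module" +
  lie_bracket :: "'l \<Rightarrow> 'l \<Rightarrow> 'l"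

locale lie_algebra = module K L for K (structure) and L :: "('k, 'l, 'm) lie_module_scheme" (structure) +
  assumes bracket_closed:
      "\<lbrakk>x \<in> carrier L; y \<in> carrier L\<rbrakk> \<Longrightarrow> lie_bracket L x y \<in> carrier L"
    and bracket_add_left:
      "\<lbrakk>x \<in> carrier L; y \<in> carrier L; z \<in> carrier L\<rbrakk> \<Longrightarrow>
       lie_bracket L (x \<oplus>\<^bsub>L\<^esub> y) z = lie_bracket L x z \<oplus>\<^bsub>L\<^esub> lie_bracket L y z"
    and bracket_add_right:
      "\<lbrakk>x \<in> carrier L; y \<in> carrier L; z \<in> carrier L\<rbrakk> \<Longrightarrow>
       lie_bracket L x (y \<oplus>\<^bsub>L\<^esub> z) = lie_bracket L x y \<oplus>\<^bsub>L\<^esub> lie_bracket L x z"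
    and bracket_smult_left:
      "\<lbrakk>c \<in> carrier K; x \<in> carrier L; y \<in> carrier L\<rbrakk> \<Longrightarrow>
       lie_bracket L (c \<odot>\<^bsub>L\<^esub> x) y = c \<odot>\<^bsub>L\<^esub> lie_bracket L x y"
    and bracket_smult_right:
      "\<lbrakk>c \<in> carrier K; x \<in> carrier L; y \<in> carrier L\<rbrakk> \<Longrightarrow>
       lie_bracket L x (c \<odot>\<^bsub>L\<^esub> y) = c \<odot>\<^bsub>L\<^esub> lie_bracket L x y"
    and bracket_alternating:
      "x \<in> carrier L \<Longrightarrow> lie_bracket L x x = \<zero>\<^bsub>L\<^esub>"
    and jacobi:
      "\<lbrakk>x \<in> carrier L; y \<in> carrier L; z \<in> carrier L\<rbrakk> \<Longrightarrow>
       lie_bracket L x (lie_bracket L y z) \<oplus>\<^bsub>L\<^esub> lie_bracket L y (lie_bracket L z x)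
         \<oplus>\<^bsub>L\<^esub> lie_bracket L z (lie_bracket L x y) = \<zero>\<^bsub>L\<^esub>"

definition lie_subalgebra ::
  "('k, 'n) ring_scheme \<Rightarrow> ('k, 'l, 'm) lie_module_scheme \<Rightarrow> 'l set \<Rightarrow> bool" where
  "lie_subalgebra K L H \<longleftrightarrow>
     submodule H K L \<and> (\<forall>x\<in>H. \<forall>y\<in>H. lie_bracket L x y \<in> H)"

definition finitely_generated_lie_algebra ::
  "('k, 'n) ring_scheme \<Rightarrow> ('k, 'l, 'm) lie_module_scheme \<Rightarrow> bool" where
  "finitely_generated_lie_algebra K L \<longleftrightarrow>
     lie_algebra K L \<and>
     (\<exists>S. finite S \<and> S \<subseteq> carrier L \<and> lie_subalgebra K L hull S = carrier L)"


section \<open>Derivations\<close>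

text \<open>
  Derivations are extensional functions, so that each derivation of \<open>A\<close> is represented by exactly
  one HOL function.
\<close>

definition derivations ::
  "('k, 'n) ring_scheme \<Rightarrow> ('k, 'a, 'm) module_scheme \<Rightarrow> ('a \<Rightarrow> 'a) set" where
  "derivations K A =
     {D \<in> carrier A \<rightarrow>\<^sub>E carrier A.
        (\<forall>a\<in>carrier A. \<forall>b\<in>carrier A. D (a \<oplus>\<^bsub>A\<^esub> b) = D a \<oplus>\<^bsub>A\<^esub> D b) \<and>
        (\<forall>c\<in>carrier K. \<forall>a\<in>carrier A. D (c \<odot>\<^bsub>A\<^esub> a) = c \<odot>\<^bsub>A\<^esub> D a) \<and>
        (\<forall>a\<in>carrier A. \<forall>b\<in>carrier A. D (a \<otimes>\<^bsub>A\<^esub> b) = a \<otimes>\<^bsub>A\<^esub> D b \<oplus>\<^bsub>A\<^esub> D a \<otimes>\<^bsub>A\<^esub> b)}"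

definition Der ::
  "('k, 'n) ring_scheme \<Rightarrow> ('k, 'a, 'm) module_scheme \<Rightarrow> ('k, 'a \<Rightarrow> 'a) lie_module" where
  "Der K A =
     \<lparr>carrier = derivations K A,
      monoid.mult = undefined,
      monoid.one = undefined,
      ring.zero = (\<lambda>a\<in>carrier A. \<zero>\<^bsub>A\<^esub>),
      ring.add = (\<lambda>D E. \<lambda>a\<in>carrier A. D a \<oplus>\<^bsub>A\<^esub> E a),
      module.smult = (\<lambda>c D. \<lambda>a\<in>carrier A. c \<odot>\<^bsub>A\<^esub> D a),
      lie_bracket = (\<lambda>D E. \<lambda>a\<in>carrier A. D (E a) \<ominus>\<^bsub>A\<^esub> E (D a))\<rparr>"

lemma Der_simps [simp]:
  "carrier (Der K A) = derivations K A"
  "ring.zero (Der K A) = (\<lambda>a\<in>carrier A. \<zero>\<^bsub>A\<^esub>)"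
  "ring.add (Der K A) = (\<lambda>D E. \<lambda>a\<in>carrier A. D a \<oplus>\<^bsub>A\<^esub> E a)"
  "smult (Der K A) = (\<lambda>c D. \<lambda>a\<in>carrier A. c \<odot>\<^bsub>A\<^esub> D a)"
  "lie_bracket (Der K A) = (\<lambda>D E. \<lambda>a\<in>carrier A. D (E a) \<ominus>\<^bsub>A\<^esub> E (D a))"
  by (simp_all add: Der_def)

lemma derivations_memD:
  assumes "D \<in> derivations K A"
  shows "D \<in> extensional (carrier A)"
    and "\<And>a. a \<in> carrier A \<Longrightarrow> D a \<in> carrier A"
    and "\<And>a b. \<lbrakk>a \<in> carrier A; b \<in> carrier A\<rbrakk> \<Longrightarrow> D (a \<oplus>\<^bsub>A\<^esub> b) = D a \<oplus>\<^bsub>A\<^esub> D b"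
    and "\<And>c a. \<lbrakk>c \<in> carrier K; a \<in> carrier A\<rbrakk> \<Longrightarrow> D (c \<odot>\<^bsub>A\<^esub> a) = c \<odot>\<^bsub>A\<^esub> D a"
    and "\<And>a b. \<lbrakk>a \<in> carrier A; b \<in> carrier A\<rbrakk> \<Longrightarrow>
           D (a \<otimes>\<^bsub>A\<^esub> b) = a \<otimes>\<^bsub>A\<^esub> D b \<oplus>\<^bsub>A\<^esub> D a \<otimes>\<^bsub>A\<^esub> b"
  using assms by (auto simp: derivations_def PiE_def)

lemma (in abelian_group) cross_terms_cancel:
  assumes "u \<in> carrier G" "w \<in> carrier G" "t \<in> carrier G" "v \<in> carrier G"
    "p \<in> carrier G" "q \<in> carrier G"
  shows "((u \<oplus> p) \<oplus> (q \<oplus> t)) \<ominus> ((w \<oplus> q) \<oplus> (p \<oplus> v)) = (u \<ominus> w) \<oplus> (t \<ominus> v)"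
proof -
  define w' v' p' q' where defs: "w' = \<ominus> w" "v' = \<ominus> v" "p' = \<ominus> p" "q' = \<ominus> q"
  have cl: "w' \<in> carrier G" "v' \<in> carrier G" "p' \<in> carrier G" "q' \<in> carrier G"
    using assms by (simp_all add: defs)
  have "((u \<oplus> p) \<oplus> (q \<oplus> t)) \<oplus> ((w' \<oplus> q') \<oplus> (p' \<oplus> v'))
      = ((u \<oplus> w') \<oplus> (t \<oplus> v')) \<oplus> ((p \<oplus> p') \<oplus> (q \<oplus> q'))"
    using assms cl by (simp add: a_ac)
  then show ?thesis
    using assms by (simp add: defs minus_eq minus_add r_neg)
qed

lemma (in abelian_group) jacobi_terms_cancel:
  assumes "p \<in> carrier G" "q \<in> carrier G" "r \<in> carrier G"
    "s \<in> carrier G" "t \<in> carrier G" "u \<in> carrier G"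
  shows "((p \<ominus> q) \<ominus> (r \<ominus> u)) \<oplus> ((r \<ominus> s) \<ominus> (t \<ominus> q)) \<oplus> ((t \<ominus> u) \<ominus> (p \<ominus> s)) = \<zero>"
proof -
  define p' q' r' s' t' u' where defs:
    "p' = \<ominus> p" "q' = \<ominus> q" "r' = \<ominus> r" "s' = \<ominus> s" "t' = \<ominus> t" "u' = \<ominus> u"
  have cl: "p' \<in> carrier G" "q' \<in> carrier G" "r' \<in> carrier G"
    "s' \<in> carrier G" "t' \<in> carrier G" "u' \<in> carrier G"
    using assms by (simp_all add: defs)
  have "((p \<oplus> q') \<oplus> (r' \<oplus> u)) \<oplus> ((r \<oplus> s') \<oplus> (t' \<oplus> q)) \<oplus> ((t \<oplus> u') \<oplus> (p' \<oplus> s))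
      = (p \<oplus> p') \<oplus> (q \<oplus> q') \<oplus> (r \<oplus> r') \<oplus> (s \<oplus> s') \<oplus> (t \<oplus> t') \<oplus> (u \<oplus> u')"
    using assms cl by (simp add: a_ac)
  then show ?thesis
    using assms by (simp add: defs minus_eq minus_add r_neg)
qed

lemma Der_is_lie_algebra:
  assumes "algebra K A"
  shows "lie_algebra K (Der K A)"
proof -
  interpret A: cring A by (rule algebra.M_cring[OF assms(1)])
  interpret algebra K A by fact
  have neg1: "(\<ominus>\<^bsub>K\<^esub> \<one>\<^bsub>K\<^esub>) \<odot>\<^bsub>A\<^esub> a = \<ominus>\<^bsub>A\<^esub> a" if "a \<in> carrier A" for a
    using that smult_l_minus[of "\<one>\<^bsub>K\<^esub>" a] by simp
  have minus: "D (\<ominus>\<^bsub>A\<^esub> a) = \<ominus>\<^bsub>A\<^esub> D a"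
    if "D \<in> derivations K A" "a \<in> carrier A" for D a
    using derivations_memD(2,4)[OF that(1)] that(2) neg1 by (metis R.a_inv_closed R.one_closed)
  note D = derivations_memD(2-5) minus
  have zero: "(\<lambda>a\<in>carrier A. \<zero>\<^bsub>A\<^esub>) \<in> derivations K A"
    by (auto simp: derivations_def)
  have add: "(\<lambda>a\<in>carrier A. D a \<oplus>\<^bsub>A\<^esub> E a) \<in> derivations K A"
    if "D \<in> derivations K A" "E \<in> derivations K A" for D E
    using that
    by (auto simp: derivations_def Pi_iff PiE_def A.a_ac A.l_distr A.r_distr smult_r_distr)
  have smult: "(\<lambda>a\<in>carrier A. c \<odot>\<^bsub>A\<^esub> D a) \<in> derivations K A"
    if c: "c \<in> carrier K" and d: "D \<in> derivations K A" for c D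
  proof -
    have "c \<odot>\<^bsub>A\<^esub> (e \<odot>\<^bsub>A\<^esub> a) = e \<odot>\<^bsub>A\<^esub> (c \<odot>\<^bsub>A\<^esub> a)" if "e \<in> carrier K" "a \<in> carrier A" for e a
      using c that by (metis R.m_comm smult_assoc1)
    moreover have "c \<odot>\<^bsub>A\<^esub> (a \<otimes>\<^bsub>A\<^esub> b) = a \<otimes>\<^bsub>A\<^esub> (c \<odot>\<^bsub>A\<^esub> b)"
      if "a \<in> carrier A" "b \<in> carrier A" for a b
      using c that by (metis A.m_comm smult_assoc2 smult_closed)
    ultimately show ?thesis
      using c d
      by (auto simp: derivations_def Pi_iff PiE_def smult_r_distr smult_assoc2)
  qed
  have bracket: "(\<lambda>a\<in>carrier A. D (E a) \<ominus>\<^bsub>A\<^esub> E (D a)) \<in> derivations K A"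
    if d: "D \<in> derivations K A" and e: "E \<in> derivations K A" for D E
  proof -
    have "D (E (a \<oplus>\<^bsub>A\<^esub> b)) \<ominus>\<^bsub>A\<^esub> E (D (a \<oplus>\<^bsub>A\<^esub> b)) =
        (D (E a) \<ominus>\<^bsub>A\<^esub> E (D a)) \<oplus>\<^bsub>A\<^esub> (D (E b) \<ominus>\<^bsub>A\<^esub> E (D b))"
      if "a \<in> carrier A" "b \<in> carrier A" for a b
      using that
      by (simp add: D[OF d] D[OF e] A.minus_eq A.minus_add A.a_ac)
    moreover have "D (E (c \<odot>\<^bsub>A\<^esub> a)) \<ominus>\<^bsub>A\<^esub> E (D (c \<odot>\<^bsub>A\<^esub> a)) =
        c \<odot>\<^bsub>A\<^esub> (D (E a) \<ominus>\<^bsub>A\<^esub> E (D a))"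
      if "c \<in> carrier K" "a \<in> carrier A" for c a
      using that
      by (simp add: D[OF d] D[OF e] A.minus_eq smult_r_distr smult_r_minus)
    moreover have "D (E (a \<otimes>\<^bsub>A\<^esub> b)) \<ominus>\<^bsub>A\<^esub> E (D (a \<otimes>\<^bsub>A\<^esub> b)) =
        a \<otimes>\<^bsub>A\<^esub> (D (E b) \<ominus>\<^bsub>A\<^esub> E (D b)) \<oplus>\<^bsub>A\<^esub> (D (E a) \<ominus>\<^bsub>A\<^esub> E (D a)) \<otimes>\<^bsub>A\<^esub> b"
      if ab: "a \<in> carrier A" "b \<in> carrier A" for a b
    proof -
      define p q r s t u v w where defs:
        "p = D a" "q = D b" "r = E a" "s = E b"
        "t = D (E a)" "u = D (E b)" "v = E (D a)" "w = E (D b)"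
      have cl: "p \<in> carrier A" "q \<in> carrier A" "r \<in> carrier A" "s \<in> carrier A"
        "t \<in> carrier A" "u \<in> carrier A" "v \<in> carrier A" "w \<in> carrier A"
        by (simp_all add: defs D[OF d] D[OF e] ab)
      have "D (E (a \<otimes>\<^bsub>A\<^esub> b)) =
          (a \<otimes>\<^bsub>A\<^esub> u \<oplus>\<^bsub>A\<^esub> p \<otimes>\<^bsub>A\<^esub> s) \<oplus>\<^bsub>A\<^esub> (r \<otimes>\<^bsub>A\<^esub> q \<oplus>\<^bsub>A\<^esub> t \<otimes>\<^bsub>A\<^esub> b)"
        by (simp add: defs D[OF d] D[OF e] ab)
      moreover have "E (D (a \<otimes>\<^bsub>A\<^esub> b)) =
          (a \<otimes>\<^bsub>A\<^esub> w \<oplus>\<^bsub>A\<^esub> r \<otimes>\<^bsub>A\<^esub> q) \<oplus>\<^bsub>A\<^esub> (p \<otimes>\<^bsub>A\<^esub> s \<oplus>\<^bsub>A\<^esub> v \<otimes>\<^bsub>A\<^esub> b)"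
        by (simp add: defs D[OF d] D[OF e] ab)
      moreover have "((a \<otimes>\<^bsub>A\<^esub> u \<oplus>\<^bsub>A\<^esub> p \<otimes>\<^bsub>A\<^esub> s) \<oplus>\<^bsub>A\<^esub> (r \<otimes>\<^bsub>A\<^esub> q \<oplus>\<^bsub>A\<^esub> t \<otimes>\<^bsub>A\<^esub> b)) \<ominus>\<^bsub>A\<^esub>
          ((a \<otimes>\<^bsub>A\<^esub> w \<oplus>\<^bsub>A\<^esub> r \<otimes>\<^bsub>A\<^esub> q) \<oplus>\<^bsub>A\<^esub> (p \<otimes>\<^bsub>A\<^esub> s \<oplus>\<^bsub>A\<^esub> v \<otimes>\<^bsub>A\<^esub> b)) =
          a \<otimes>\<^bsub>A\<^esub> (u \<ominus>\<^bsub>A\<^esub> w) \<oplus>\<^bsub>A\<^esub> (t \<ominus>\<^bsub>A\<^esub> v) \<otimes>\<^bsub>A\<^esub> b"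
        using cl ab A.cross_terms_cancel[of "a \<otimes>\<^bsub>A\<^esub> u" "a \<otimes>\<^bsub>A\<^esub> w" "t \<otimes>\<^bsub>A\<^esub> b" "v \<otimes>\<^bsub>A\<^esub> b"]
        by (simp add: A.minus_eq A.r_distr A.l_distr A.r_minus A.l_minus)
      ultimately show ?thesis
        by (simp add: defs)
    qed
    ultimately show ?thesis
      by (auto simp: derivations_def D[OF d] D[OF e])
  qed
  have "abelian_group (Der K A)"
  proof (rule abelian_groupI)
    fix D assume d: "D \<in> carrier (Der K A)"
    have "(\<ominus>\<^bsub>K\<^esub> \<one>\<^bsub>K\<^esub>) \<odot>\<^bsub>Der K A\<^esub> D \<oplus>\<^bsub>Der K A\<^esub> D = \<zero>\<^bsub>Der K A\<^esub>"
      using d by (auto intro!: restrict_ext simp: neg1 derivations_memD(2) A.l_neg)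
    then show "\<exists>E\<in>carrier (Der K A). E \<oplus>\<^bsub>Der K A\<^esub> D = \<zero>\<^bsub>Der K A\<^esub>"
      using d smult[of "\<ominus>\<^bsub>K\<^esub> \<one>\<^bsub>K\<^esub>" D]
      by (intro bexI[where x = "(\<ominus>\<^bsub>K\<^esub> \<one>\<^bsub>K\<^esub>) \<odot>\<^bsub>Der K A\<^esub> D"]) simp_all
    show "\<zero>\<^bsub>Der K A\<^esub> \<oplus>\<^bsub>Der K A\<^esub> D = D"
      using d by (intro extensionalityI[where A = "carrier A"]) (auto simp: derivations_memD(1,2))
  qed (auto simp: zero add derivations_memD(2) A.a_ac intro!: restrict_ext)
  then have "module K (Der K A)"
  proof (rule moduleI[OF R_cring])
    fix D assume "D \<in> carrier (Der K A)"
    then show "\<one>\<^bsub>K\<^esub> \<odot>\<^bsub>Der K A\<^esub> D = D"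
      by (intro extensionalityI[where A = "carrier A"]) (auto simp: derivations_memD(1,2))
  qed (auto simp: smult derivations_memD(2) smult_l_distr smult_r_distr smult_assoc1 intro!: restrict_ext)
  moreover have "lie_algebra_axioms K (Der K A)"
  proof (unfold_locales, goal_cases)
    case 1 then show ?case by (simp add: bracket)
  next
    case (2 D E F)
    then have "D \<in> derivations K A" "E \<in> derivations K A" "F \<in> derivations K A"
      by simp_all
    note D' = this[THEN D(1)] this(3)[THEN D(2)]
    show ?case
      by (auto intro!: restrict_ext simp: D' A.minus_eq A.minus_add A.a_ac)
  next
    case (3 D E F)
    then have "D \<in> derivations K A" "E \<in> derivations K A" "F \<in> derivations K A"
      by simp_all
    note D' = this[THEN D(1)] this(1)[THEN D(2)]
    show ?case
      by (auto intro!: restrict_ext simp: D' A.minus_eq A.minus_add A.a_ac)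
  next
    case (4 c D E)
    then have "D \<in> derivations K A" "E \<in> derivations K A" and c: "c \<in> carrier K"
      by simp_all
    note D' = this(1,2)[THEN D(1)] this(2)[THEN D(3)]
    show ?case
      using c by (auto intro!: restrict_ext simp: D' A.minus_eq smult_r_distr smult_r_minus)
  next
    case (5 c D E)
    then have "D \<in> derivations K A" "E \<in> derivations K A" and c: "c \<in> carrier K"
      by simp_all
    note D' = this(1,2)[THEN D(1)] this(1)[THEN D(3)]
    show ?case
      using c by (auto intro!: restrict_ext simp: D' A.minus_eq smult_r_distr smult_r_minus)
  next
    case (6 D)
    then show ?case
      by (auto intro!: restrict_ext simp: derivations_memD(2) A.r_neg A.minus_eq)
  next
    case (7 D E F)
    then have d: "D \<in> derivations K A" and e: "E \<in> derivations K A" and f: "F \<in> derivations K A"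
      by simp_all
    note D' = D[OF d] D[OF e] D[OF f]
    have "((D (E (F a)) \<ominus>\<^bsub>A\<^esub> D (F (E a))) \<ominus>\<^bsub>A\<^esub> (E (F (D a)) \<ominus>\<^bsub>A\<^esub> F (E (D a))))
        \<oplus>\<^bsub>A\<^esub> ((E (F (D a)) \<ominus>\<^bsub>A\<^esub> E (D (F a))) \<ominus>\<^bsub>A\<^esub> (F (D (E a)) \<ominus>\<^bsub>A\<^esub> D (F (E a))))
        \<oplus>\<^bsub>A\<^esub> ((F (D (E a)) \<ominus>\<^bsub>A\<^esub> F (E (D a))) \<ominus>\<^bsub>A\<^esub> (D (E (F a)) \<ominus>\<^bsub>A\<^esub> E (D (F a)))) = \<zero>\<^bsub>A\<^esub>"
      if a: "a \<in> carrier A" for a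
    proof -
      define p q r s t u where defs:
        "p = D (E (F a))" "q = D (F (E a))" "r = E (F (D a))"
        "s = E (D (F a))" "t = F (D (E a))" "u = F (E (D a))"
      have "p \<in> carrier A" "q \<in> carrier A" "r \<in> carrier A"
        "s \<in> carrier A" "t \<in> carrier A" "u \<in> carrier A"
        using a by (simp_all add: defs D')
      then have "((p \<ominus>\<^bsub>A\<^esub> q) \<ominus>\<^bsub>A\<^esub> (r \<ominus>\<^bsub>A\<^esub> u)) \<oplus>\<^bsub>A\<^esub> ((r \<ominus>\<^bsub>A\<^esub> s) \<ominus>\<^bsub>A\<^esub> (t \<ominus>\<^bsub>A\<^esub> q))
          \<oplus>\<^bsub>A\<^esub> ((t \<ominus>\<^bsub>A\<^esub> u) \<ominus>\<^bsub>A\<^esub> (p \<ominus>\<^bsub>A\<^esub> s)) = \<zero>\<^bsub>A\<^esub>"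
        by (rule A.jacobi_terms_cancel)
      then show ?thesis
        by (simp add: defs)
    qed
    moreover have "G (x \<ominus>\<^bsub>A\<^esub> y) = G x \<ominus>\<^bsub>A\<^esub> G y"
      if "G \<in> derivations K A" "x \<in> carrier A" "y \<in> carrier A" for G x y
      using that by (simp add: A.minus_eq D[OF that(1)])
    note this[OF d] this[OF e] this[OF f]
    ultimately show ?case
      by (auto intro!: restrict_ext simp: D')
  qed
  ultimately show ?thesis
    by (rule lie_algebra.intro)
qed

end

theory Submission
  imports Defs "HOL-Library.Countable_Set"
begin

text \<open>
  Smoothness enters only through a dual basis: a finite set \<open>G\<close> of generators of \<open>A\<close> and
  derivations \<open>B x\<close>, one for each \<open>x \<in> G\<close>, with \<open>E = \<Sum>\<^sub>x E(x) B x\<close> for every derivation \<open>E\<close>.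
  This expresses that the module of differentials is a direct summand of a free module on the
  symbols \<open>dx\<close>. To obtain it (\<open>smooth_derivation_basis\<close>), consider the algebra of pairs \<open>(a, b)\<close>,
  with \<open>b\<close> a family of elements of \<open>A\<close> indexed by \<open>G\<close>, in which \<open>(a, b) (a', b') =
  (a a', a b' + a' b)\<close>, and in it the subalgebra of those pairs that satisfy
  \<open>E(a) = \<Sum>\<^sub>x b\<^sub>x E(x)\<close> for all derivations \<open>E\<close>. It contains a pair over each generator, so it maps
  onto \<open>A\<close>, with square-zero kernel. By smoothness the projection has a section
  \<open>a \<mapsto> (a, (B x a)\<^sub>x)\<close>. That the section is multiplicative says that the \<open>B x\<close> are derivations, and
  that its values satisfy the defining condition says that they form a dual basis. The lifting
  property is available for one type of elements only; the pairs embed into that type because every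
  element of \<open>A\<close> is a linear combination of the countably many monomials in \<open>G\<close>
  (\<open>embedding_into_coefficient_functions\<close>).

  Write \<open>\<sigma>(D, E, a) = D(a) E + E(a) D\<close>. The engine is the identity
  \<open>f g \<sigma>(D, E, z) = [f D, z g E] - [z f D, g E]\<close> (\<open>symmetrized_by_brackets\<close>): all derivatives of
  \<open>f\<close> and \<open>g\<close> cancel, and the coefficients \<open>f, g, z f, z g\<close> on the right can each be much shorter
  than the product \<open>f g\<close>. It remains to know that the \<open>\<sigma>(D, E, a)\<close> span the \<open>A\<close>-module of derivations
  (\<open>derivations_symmetrically_spanned\<close>), and this is where \<open>2\<close> has to be invertible. Let \<open>N\<close> be
  their span. Since \<open>\<sigma>(E, E, a) = 2 E(a) E\<close>, the span contains \<open>E(a) E\<close>, hence also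
  \<open>E(a)\<^sup>2 D = E(a) \<sigma>(E, D, a) - D(a) E(a) E\<close> for all \<open>D\<close>. So the squares of the finitely many elements
  \<open>B x y\<close> map all derivations into \<open>N\<close>, whereas \<open>B x = \<Sum>\<^sub>y (B x y) B y\<close> shows that the multiples
  of the derivations by these elements already span everything. Together the two facts force \<open>N\<close> to
  be everything (\<open>covered_by_square_multiples\<close>).

  Now each \<open>B x\<close> is a combination of elements \<open>\<sigma>(B y, B y', z)\<close> with coefficients in a finite set \<open>F\<close>.
  The derivations \<open>w B x\<close>, where \<open>w\<close> runs through the words of length at most four over \<open>G \<union> F\<close>,
  generate: for a longer word \<open>w\<close> of length \<open>n\<close>, the derivation \<open>w B x\<close> is a sum of terms
  \<open>w f \<sigma>(B y, B y', z)\<close>, the word \<open>w f\<close> of length \<open>n + 1\<close> can be cut into two words of lengths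
  \<open>3\<close> and \<open>n - 2\<close>, and in the identity above these are prolonged by at most one letter, hence remain
  shorter than \<open>w\<close> (\<open>monomial_multiples_in_subalgebra\<close>).
\<close>


section \<open>Linear combinations\<close>

text \<open>
  Coefficients are restricted to a set so that the statement that finitely many coefficients suffice
  for a given combination can be expressed. With all scalars allowed this is the span of \<open>W\<close>.
\<close>

inductive_set combinations :: "'k set \<Rightarrow> ('k, 'l, 'm) module_scheme \<Rightarrow> 'l set \<Rightarrow> 'l set"
  for C M W where
  zero: "\<zero>\<^bsub>M\<^esub> \<in> combinations C M W"
| add: "\<lbrakk>c \<in> C; w \<in> W; v \<in> combinations C M W\<rbrakk> \<Longrightarrow>
    (c \<odot>\<^bsub>M\<^esub> w) \<oplus>\<^bsub>M\<^esub> v \<in> combinations C M W"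

lemma combinations_mono:
  assumes "v \<in> combinations C M W" "C \<subseteq> C'" "W \<subseteq> W'"
  shows "v \<in> combinations C' M W'"
  using assms(1) by induction (use assms(2,3) in \<open>auto intro: combinations.intros\<close>)

lemma combinations_finitary:
  assumes "v \<in> combinations C M W"
  shows "\<exists>F. finite F \<and> F \<subseteq> C \<and> v \<in> combinations F M W"
  using assms
proof induction
  case zero
  show ?case by (auto intro: combinations.zero)
next
  case (add c w v)
  then obtain F where F: "finite F" "F \<subseteq> C" "v \<in> combinations F M W" by blast
  with add show ?case
    by (intro exI[of _ "insert c F"])
      (auto intro!: combinations.add intro: combinations_mono[OF F(3)])
qed

lemma combinations_family_finitary:
  assumes "finite G" and "\<And>x. x \<in> G \<Longrightarrow> B x \<in> combinations C M W"
  shows "\<exists>F. finite F \<and> F \<subseteq> C \<and> (\<forall>x\<in>G. B x \<in> combinations F M W)"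
proof -
  have "\<forall>x\<in>G. \<exists>F. finite F \<and> F \<subseteq> C \<and> B x \<in> combinations F M W"
    by (intro ballI combinations_finitary assms(2))
  then obtain F where "\<forall>x\<in>G. finite (F x) \<and> F x \<subseteq> C \<and> B x \<in> combinations (F x) M W"
    by (auto dest!: bchoice)
  then show ?thesis
    using assms(1)
    by (intro exI[of _ "\<Union>x\<in>G. F x"]) (auto intro: combinations_mono[where C = "F _"])
qed

context module
begin

lemma submodule_facts:
  assumes "submodule N R M"
  shows "N \<subseteq> carrier M" "\<zero>\<^bsub>M\<^esub> \<in> N"
    "\<And>v w. \<lbrakk>v \<in> N; w \<in> N\<rbrakk> \<Longrightarrow> v \<oplus>\<^bsub>M\<^esub> w \<in> N"
    "\<And>c v. \<lbrakk>c \<in> carrier R; v \<in> N\<rbrakk> \<Longrightarrow> c \<odot>\<^bsub>M\<^esub> v \<in> N"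
  using submoduleE[OF assms] subgroup.one_closed[OF submodule.axioms(1)[OF assms]] by auto

lemma submodule_by_closure:
  assumes "N \<subseteq> carrier M" "\<zero>\<^bsub>M\<^esub> \<in> N"
    and "\<And>v w. \<lbrakk>v \<in> N; w \<in> N\<rbrakk> \<Longrightarrow> v \<oplus>\<^bsub>M\<^esub> w \<in> N"
    and "\<And>c v. \<lbrakk>c \<in> carrier R; v \<in> N\<rbrakk> \<Longrightarrow> c \<odot>\<^bsub>M\<^esub> v \<in> N"
  shows "submodule N R M"
proof (rule submoduleI)
  fix v assume v: "v \<in> N"
  then have "(\<ominus> \<one>) \<odot>\<^bsub>M\<^esub> v = \<ominus>\<^bsub>M\<^esub> v"
    using assms(1) smult_l_minus[of \<one> v] by auto
  then show "\<ominus>\<^bsub>M\<^esub> v \<in> N"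
    using assms(4)[of "\<ominus> \<one>" v] v by simp
qed (use assms in auto)

lemma submodule_minus:
  assumes "submodule N R M" "v \<in> N" "w \<in> N"
  shows "v \<ominus>\<^bsub>M\<^esub> w \<in> N"
  using submoduleE[OF assms(1)] assms(2,3) by (simp add: M.minus_eq)

lemma combinations_in_submodule:
  assumes "submodule N R M" "C \<subseteq> carrier R" "W \<subseteq> N" "v \<in> combinations C M W"
  shows "v \<in> N"
  using assms(4)
  by induction (use assms(2,3) in \<open>blast intro: submodule_facts(2-4)[OF assms(1)]\<close>)+

lemma combinations_carrier:
  assumes "C \<subseteq> carrier R" "W \<subseteq> carrier M" "v \<in> combinations C M W"
  shows "v \<in> carrier M"
  using combinations_in_submodule[OF carrier_is_submodule assms] .

lemma combinations_submodule:
  assumes W: "W \<subseteq> carrier M"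
  shows "submodule (combinations (carrier R) M W) R M"
proof (rule submodule_by_closure)
  have car: "v \<in> carrier M" if "v \<in> combinations (carrier R) M W" for v
    using combinations_carrier[OF _ W that] by simp
  then show "combinations (carrier R) M W \<subseteq> carrier M" by blast
  fix v assume v: "v \<in> combinations (carrier R) M W"
  show "v \<oplus>\<^bsub>M\<^esub> u \<in> combinations (carrier R) M W" if u: "u \<in> combinations (carrier R) M W" for u
    using v
  proof induction
    case zero
    then show ?case using u car by simp
  next
    case (add c w v)
    then show ?case
      using combinations.add[OF add(1,2,4)] car[OF u] car[OF add(3)] W
      by (simp add: M.a_assoc subset_iff)
  qed
  show "d \<odot>\<^bsub>M\<^esub> v \<in> combinations (carrier R) M W" if d: "d \<in> carrier R" for d
    using v
  proof induction
    case zero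
    then show ?case using d by (simp add: combinations.zero)
  next
    case (add c w v)
    have "w \<in> carrier M" using add(2) W by blast
    then show ?case
      using combinations.add[OF _ add(2,4), of "d \<otimes> c"] car[OF add(3)] d add(1)
      by (simp add: smult_r_distr smult_assoc1)
  qed
qed (rule combinations.zero)

lemma generator_in_combinations:
  assumes "W \<subseteq> carrier M" "w \<in> W"
  shows "w \<in> combinations (carrier R) M W"
  using combinations.add[OF R.one_closed assms(2) combinations.zero, of M] assms
  by (simp add: subset_iff)

text \<open>
  In this form a combination is determined by the coefficient function on \<open>W\<close>, which is
  what an injective coding of the elements of a module needs.
\<close>

lemma combinations_finsum:
  assumes W: "W \<subseteq> carrier M" and v: "v \<in> combinations (carrier R) M W"
  shows "\<exists>c. finite {w \<in> W. c w \<noteq> \<zero>} \<and> c \<in> W \<rightarrow> carrier R \<and>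
    v = (\<Oplus>\<^bsub>M\<^esub>w\<in>{w \<in> W. c w \<noteq> \<zero>}. c w \<odot>\<^bsub>M\<^esub> w)"
  using v
proof induction
  case zero
  show ?case by (rule exI[of _ "\<lambda>_. \<zero>"]) simp
next
  case (add a u v)
  then obtain c where c: "finite {w \<in> W. c w \<noteq> \<zero>}" "c \<in> W \<rightarrow> carrier R"
    and v: "v = (\<Oplus>\<^bsub>M\<^esub>w\<in>{w \<in> W. c w \<noteq> \<zero>}. c w \<odot>\<^bsub>M\<^esub> w)"
    by blast
  have u: "u \<in> carrier M" using add(2) W by blast
  \<comment> \<open>The vector \<open>u\<close> may already occur in \<open>v\<close>, and its new coefficient may vanish.\<close>
  define d where "d = c(u := a \<oplus> c u)"
  define T where "T = {w \<in> W. c w \<noteq> \<zero>} - {u}"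
  have T: "finite T" "u \<notin> T" "T \<subseteq> W" using c(1) by (auto simp: T_def)
  have cu: "c u \<in> carrier R" using c(2) add(2) by blast
  have dW: "d \<in> W \<rightarrow> carrier R" using c(2) add(1) cu by (auto simp: d_def Pi_iff)
  have summand: "f w \<odot>\<^bsub>M\<^esub> w \<in> carrier M" if "f \<in> W \<rightarrow> carrier R" "w \<in> W" for f w
    using that W by blast
  have widen: "(\<Oplus>\<^bsub>M\<^esub>w\<in>{w \<in> W. f w \<noteq> \<zero>}. f w \<odot>\<^bsub>M\<^esub> w)
      = (f u \<odot>\<^bsub>M\<^esub> u) \<oplus>\<^bsub>M\<^esub> (\<Oplus>\<^bsub>M\<^esub>w\<in>T. f w \<odot>\<^bsub>M\<^esub> w)"
    if "f \<in> W \<rightarrow> carrier R" "{w \<in> W. f w \<noteq> \<zero>} \<subseteq> insert u T" for f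
  proof -
    have "(\<Oplus>\<^bsub>M\<^esub>w\<in>{w \<in> W. f w \<noteq> \<zero>}. f w \<odot>\<^bsub>M\<^esub> w) = (\<Oplus>\<^bsub>M\<^esub>w\<in>insert u T. f w \<odot>\<^bsub>M\<^esub> w)"
    proof (rule M.add.finprod_mono_neutral_cong_left)
      show "f w \<odot>\<^bsub>M\<^esub> w = \<zero>\<^bsub>M\<^esub>" if "w \<in> insert u T - {w \<in> W. f w \<noteq> \<zero>}" for w
        using that T(3) add(2) W by auto
    qed (use that T add(2) summand in auto)
    also have "\<dots> = (f u \<odot>\<^bsub>M\<^esub> u) \<oplus>\<^bsub>M\<^esub> (\<Oplus>\<^bsub>M\<^esub>w\<in>T. f w \<odot>\<^bsub>M\<^esub> w)"
      using T add(2) summand[OF that(1)] by (intro M.add.finprod_insert) auto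
    finally show ?thesis .
  qed
  have supp: "{w \<in> W. d w \<noteq> \<zero>} \<subseteq> insert u T" "{w \<in> W. c w \<noteq> \<zero>} \<subseteq> insert u T"
    by (auto simp: d_def T_def)
  have sum_T: "(\<Oplus>\<^bsub>M\<^esub>w\<in>T. d w \<odot>\<^bsub>M\<^esub> w) = (\<Oplus>\<^bsub>M\<^esub>w\<in>T. c w \<odot>\<^bsub>M\<^esub> w)"
    by (rule M.add.finprod_cong') (use T summand[OF c(2)] in \<open>auto simp: d_def\<close>)
  have TM: "(\<Oplus>\<^bsub>M\<^esub>w\<in>T. c w \<odot>\<^bsub>M\<^esub> w) \<in> carrier M"
    using T(3) summand[OF c(2)] by (intro M.add.finprod_closed) auto
  have "a \<odot>\<^bsub>M\<^esub> u \<oplus>\<^bsub>M\<^esub> v = (\<Oplus>\<^bsub>M\<^esub>w\<in>{w \<in> W. d w \<noteq> \<zero>}. d w \<odot>\<^bsub>M\<^esub> w)"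
    unfolding v widen[OF dW supp(1)] widen[OF c(2) supp(2)] sum_T
    using u cu add(1) TM by (simp add: d_def smult_l_distr M.a_assoc)
  moreover have "finite {w \<in> W. d w \<noteq> \<zero>}"
    using supp(1) T(1) finite_subset by blast
  ultimately show ?case using dW by blast
qed

lemma submodule_add_cancel:
  assumes "submodule N R M" "v \<in> carrier M" "w \<in> N" "v \<oplus>\<^bsub>M\<^esub> w \<in> N"
  shows "v \<in> N"
proof -
  have "w \<in> carrier M" using submodule_facts(1)[OF assms(1)] assms(3) by blast
  then have "(v \<oplus>\<^bsub>M\<^esub> w) \<ominus>\<^bsub>M\<^esub> w = v"
    using assms(2) by (simp add: M.minus_eq M.a_assoc M.r_neg)
  then show ?thesis using submodule_minus[OF assms(1,4,3)] by simp
qed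

text \<open>
  If \<open>M = P M + N\<close> and \<open>p\<^sup>2 M \<subseteq> N\<close> for \<open>p \<in> P\<close>, then multiplying the first equation by one \<open>p\<close> gives
  \<open>p M \<subseteq> N + P' M\<close> with \<open>P' = P - {p}\<close>, so \<open>p\<close> can be dropped from \<open>P\<close>. Repeating this exhausts \<open>P\<close>.
\<close>

lemma covered_by_square_multiples:
  assumes "finite P" "P \<subseteq> carrier R" and N: "submodule N R M"
    and "\<And>p v. \<lbrakk>p \<in> P; v \<in> carrier M\<rbrakk> \<Longrightarrow> (p \<otimes> p) \<odot>\<^bsub>M\<^esub> v \<in> N"
    and "carrier M \<subseteq> combinations (carrier R) M (N \<union> {p \<odot>\<^bsub>M\<^esub> v | p v. p \<in> P \<and> v \<in> carrier M})"
  shows "carrier M \<subseteq> N"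
  using assms(1,2,4,5)
proof (induction P)
  case empty
  show ?case
  proof
    fix v assume "v \<in> carrier M"
    then have "v \<in> combinations (carrier R) M N" using empty.prems(3) by auto
    then show "v \<in> N" by (rule combinations_in_submodule[OF N subset_refl subset_refl])
  qed
next
  case (insert p P)
  let ?W = "N \<union> {q \<odot>\<^bsub>M\<^esub> v | q v. q \<in> P \<and> v \<in> carrier M}"
  let ?N = "combinations (carrier R) M ?W"
  have p: "p \<in> carrier R" and P: "P \<subseteq> carrier R" using insert.prems(1) by auto
  have NM: "N \<subseteq> carrier M" by (rule submodule_facts(1)[OF N])
  have W: "?W \<subseteq> carrier M" using NM P by auto
  have sub: "submodule ?N R M" by (rule combinations_submodule[OF W])
  note gen = generator_in_combinations[OF W]
  have sub_p: "submodule {v \<in> carrier M. p \<odot>\<^bsub>M\<^esub> v \<in> ?N} R M"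
  proof (rule submodule_by_closure)
    fix c v assume c: "c \<in> carrier R" and v: "v \<in> {v \<in> carrier M. p \<odot>\<^bsub>M\<^esub> v \<in> ?N}"
    then have "p \<odot>\<^bsub>M\<^esub> (c \<odot>\<^bsub>M\<^esub> v) = c \<odot>\<^bsub>M\<^esub> (p \<odot>\<^bsub>M\<^esub> v)"
      using p by (simp add: smult_assoc1[symmetric] R.m_comm)
    then show "c \<odot>\<^bsub>M\<^esub> v \<in> {v \<in> carrier M. p \<odot>\<^bsub>M\<^esub> v \<in> ?N}"
      using c v submodule_facts(4)[OF sub] by simp
  qed (use p submodule_facts(2,3)[OF sub] in \<open>auto simp: smult_r_distr\<close>)
  have "N \<union> {q \<odot>\<^bsub>M\<^esub> v | q v. q \<in> insert p P \<and> v \<in> carrier M} \<subseteq> {v \<in> carrier M. p \<odot>\<^bsub>M\<^esub> v \<in> ?N}"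
  proof -
    have "p \<odot>\<^bsub>M\<^esub> v \<in> ?N" if "v \<in> N" for v
      using gen submodule_facts(4)[OF N p that] by simp
    moreover have "p \<odot>\<^bsub>M\<^esub> (p \<odot>\<^bsub>M\<^esub> v) \<in> ?N" if "v \<in> carrier M" for v
      using gen insert.prems(2)[of p v] p that by (simp add: smult_assoc1)
    moreover have "p \<odot>\<^bsub>M\<^esub> (q \<odot>\<^bsub>M\<^esub> v) \<in> ?N" if q: "q \<in> P" and v: "v \<in> carrier M" for q v
    proof -
      have "p \<odot>\<^bsub>M\<^esub> (q \<odot>\<^bsub>M\<^esub> v) = q \<odot>\<^bsub>M\<^esub> (p \<odot>\<^bsub>M\<^esub> v)"
        using p P q v by (simp add: smult_assoc1[symmetric] R.m_comm subset_iff)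
      moreover have "q \<odot>\<^bsub>M\<^esub> (p \<odot>\<^bsub>M\<^esub> v) \<in> ?W" using p q v by blast
      ultimately show ?thesis using gen by simp
    qed
    ultimately show ?thesis using NM p P by auto
  qed
  then have "carrier M \<subseteq> {v \<in> carrier M. p \<odot>\<^bsub>M\<^esub> v \<in> ?N}"
    using combinations_in_submodule[OF sub_p subset_refl] insert.prems(3) by blast
  then have "N \<union> {q \<odot>\<^bsub>M\<^esub> v | q v. q \<in> insert p P \<and> v \<in> carrier M} \<subseteq> ?N"
    using gen by auto
  then have "carrier M \<subseteq> ?N"
    using combinations_in_submodule[OF sub subset_refl] insert.prems(3) by blast
  then show ?case
    using insert.IH P insert.prems(2) by simp
qed

end


section \<open>Algebras generated by a set\<close>

text \<open>
  Words are kept as lists, not as exponent vectors: the final induction cuts them into two pieces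
  by length.
\<close>

definition monomial :: "('k, 'a, 'm) module_scheme \<Rightarrow> 'a list \<Rightarrow> 'a" where
  "monomial A ws = foldr (monoid.mult A) ws \<one>\<^bsub>A\<^esub>"

lemma monomial_simps [simp]:
  "monomial A [] = \<one>\<^bsub>A\<^esub>"
  "monomial A (x # ws) = x \<otimes>\<^bsub>A\<^esub> monomial A ws"
  by (simp_all add: monomial_def)

locale commutative_algebra = A: cring A + algebra K A
  for A :: "('k, 'a, 'm) module_scheme" (structure) and K :: "('k, 'n) ring_scheme"
begin

lemma monomial_closed [simp]: "ws \<in> lists (carrier A) \<Longrightarrow> monomial A ws \<in> carrier A"
  by (induction ws) auto

lemma monomial_append:
  "\<lbrakk>us \<in> lists (carrier A); ws \<in> lists (carrier A)\<rbrakk> \<Longrightarrow>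
   monomial A (us @ ws) = monomial A us \<otimes> monomial A ws"
  by (induction us) (auto simp: A.m_assoc)

lemma unital_subalgebraI:
  assumes "B \<subseteq> carrier A" "\<one> \<in> B"
    and "\<And>a b. \<lbrakk>a \<in> B; b \<in> B\<rbrakk> \<Longrightarrow> a \<oplus> b \<in> B"
    and "\<And>a b. \<lbrakk>a \<in> B; b \<in> B\<rbrakk> \<Longrightarrow> a \<otimes> b \<in> B"
    and "\<And>c a. \<lbrakk>c \<in> carrier K; a \<in> B\<rbrakk> \<Longrightarrow> c \<odot> a \<in> B"
  shows "unital_subalgebra K A B"
  unfolding unital_subalgebra_def
proof (intro conjI A.subringI)
  fix a assume a: "a \<in> B"
  then have "(\<ominus>\<^bsub>K\<^esub> \<one>\<^bsub>K\<^esub>) \<odot> a = \<ominus> a"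
    using assms(1) smult_l_minus[of "\<one>\<^bsub>K\<^esub>" a] by auto
  then show "\<ominus> a \<in> B"
    using assms(5)[of "\<ominus>\<^bsub>K\<^esub> \<one>\<^bsub>K\<^esub>" a] a by simp
qed (use assms in auto)

lemma generated_induct [consumes 2, case_names carrier generator one add mult smult]:
  assumes "unital_subalgebra K A hull G = carrier A" "a \<in> carrier A"
    and "G \<subseteq> carrier A"
    and "\<And>x. x \<in> G \<Longrightarrow> P x" "P \<one>"
    and "\<And>a b. \<lbrakk>a \<in> carrier A; b \<in> carrier A; P a; P b\<rbrakk> \<Longrightarrow> P (a \<oplus> b)"
    and "\<And>a b. \<lbrakk>a \<in> carrier A; b \<in> carrier A; P a; P b\<rbrakk> \<Longrightarrow> P (a \<otimes> b)"
    and "\<And>c a. \<lbrakk>c \<in> carrier K; a \<in> carrier A; P a\<rbrakk> \<Longrightarrow> P (c \<odot> a)"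
  shows "P a"
proof -
  have "unital_subalgebra K A {a \<in> carrier A. P a}"
    by (rule unital_subalgebraI) (use assms in auto)
  then have "unital_subalgebra K A hull G \<subseteq> {a \<in> carrier A. P a}"
    by (rule hull_minimal[rotated]) (use assms in auto)
  then show ?thesis using assms(1,2) by blast
qed

lemma combinations_of_monomials:
  assumes "unital_subalgebra K A hull G = carrier A" "G \<subseteq> carrier A" "a \<in> carrier A"
  shows "a \<in> combinations (carrier K) A (monomial A ` lists G)"
proof -
  let ?W = "monomial A ` lists G"
  let ?S = "combinations (carrier K) A ?W"
  have lists: "lists G \<subseteq> lists (carrier A)" using assms(2) by (rule lists_mono)
  then have W: "?W \<subseteq> carrier A" using monomial_closed by blast
  note S = submodule_facts[OF combinations_submodule[OF W]]
  have gen: "monomial A ws \<in> ?S" if "ws \<in> lists G" for ws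
    using generator_in_combinations[OF W] that by blast
  have mult_monomial: "w \<otimes> b \<in> ?S" if w: "w \<in> ?W" and b: "b \<in> ?S" for w b
    using b
  proof induction
    case zero
    then show ?case using w W S(2) by auto
  next
    case (add c v b)
    obtain us vs where "us \<in> lists G" "vs \<in> lists G" "w = monomial A us" "v = monomial A vs"
      using w add(2) by blast
    then have "w \<otimes> v = monomial A (us @ vs)" "us @ vs \<in> lists G"
      using lists by (auto simp: monomial_append subset_iff)
    then have wv: "w \<otimes> v \<in> ?S" using gen by simp
    have cl: "w \<in> carrier A" "v \<in> carrier A" "b \<in> carrier A"
      using w add(2,3) W S(1) by auto
    then have "w \<otimes> (c \<odot> v) = c \<odot> (w \<otimes> v)"
      using smult_assoc2[of c v w] add(1) by (simp add: A.m_comm)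
    then show ?case
      using cl add S(3) S(4)[OF add(1) wv] by (simp add: A.r_distr)
  qed
  have mult: "a \<otimes> b \<in> ?S" if a: "a \<in> ?S" and b: "b \<in> ?S" for a b
    using a
  proof induction
    case zero
    then show ?case using b S(1,2) by auto
  next
    case (add c w a)
    have cl: "w \<in> carrier A" "a \<in> carrier A" "b \<in> carrier A"
      using add(2,3) b W S(1) by auto
    then show ?case
      using add S(3) S(4)[OF add(1) mult_monomial[OF add(2) b]]
      by (simp add: A.l_distr smult_assoc2)
  qed
  have "unital_subalgebra K A ?S"
  proof (rule unital_subalgebraI)
    show "\<one> \<in> ?S" using gen[of "[]"] by simp
  qed (use S mult in auto)
  moreover have "G \<subseteq> ?S"
  proof
    fix x assume "x \<in> G"
    then show "x \<in> ?S" using gen[of "[x]"] assms(2) by auto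
  qed
  ultimately have "unital_subalgebra K A hull G \<subseteq> ?S"
    by (intro hull_minimal)
  then show ?thesis using assms by blast
qed

end


section \<open>Derivations as a module\<close>

text \<open>
  The same additive group as \<open>Der K A\<close>, but with scalars from \<open>A\<close>. The bracket is not
  bilinear over \<open>A\<close>, so the two structures have to be kept apart.
\<close>

definition Der_module :: "('k, 'n) ring_scheme \<Rightarrow> ('k, 'a, 'm) module_scheme \<Rightarrow> ('a, 'a \<Rightarrow> 'a) module"
  where
  "Der_module K A =
     \<lparr>carrier = derivations K A,
      monoid.mult = undefined,
      monoid.one = undefined,
      ring.zero = (\<lambda>a\<in>carrier A. \<zero>\<^bsub>A\<^esub>),
      ring.add = (\<lambda>D E. \<lambda>a\<in>carrier A. D a \<oplus>\<^bsub>A\<^esub> E a),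
      module.smult = (\<lambda>f D. \<lambda>a\<in>carrier A. f \<otimes>\<^bsub>A\<^esub> D a)\<rparr>"

lemma Der_module_simps [simp]:
  "carrier (Der_module K A) = derivations K A"
  "ring.zero (Der_module K A) = (\<lambda>a\<in>carrier A. \<zero>\<^bsub>A\<^esub>)"
  "ring.add (Der_module K A) = (\<lambda>D E. \<lambda>a\<in>carrier A. D a \<oplus>\<^bsub>A\<^esub> E a)"
  "smult (Der_module K A) = (\<lambda>f D. \<lambda>a\<in>carrier A. f \<otimes>\<^bsub>A\<^esub> D a)"
  by (simp_all add: Der_module_def)

context commutative_algebra
begin

abbreviation der_smult :: "'a \<Rightarrow> ('a \<Rightarrow> 'a) \<Rightarrow> 'a \<Rightarrow> 'a" (infixr \<open>\<Zspot>\<close> 75) where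
  "f \<Zspot> D \<equiv> f \<odot>\<^bsub>Der_module K A\<^esub> D"

abbreviation der_add :: "('a \<Rightarrow> 'a) \<Rightarrow> ('a \<Rightarrow> 'a) \<Rightarrow> 'a \<Rightarrow> 'a" (infixl \<open>\<boxplus>\<close> 65) where
  "D \<boxplus> E \<equiv> D \<oplus>\<^bsub>Der_module K A\<^esub> E"

lemma algebra_axiom: "algebra K A" ..

lemmas der_closed [simp] = derivations_memD(2)[where K = K and A = A]
lemmas der_add_arg = derivations_memD(3)[where K = K and A = A]
lemmas der_smult_arg = derivations_memD(4)[where K = K and A = A]
lemmas der_mult_arg = derivations_memD(5)[where K = K and A = A]

lemma der_zero [simp]: "D \<in> derivations K A \<Longrightarrow> D \<zero> = \<zero>"
  using der_smult_arg[of D "\<zero>\<^bsub>K\<^esub>" \<zero>] by simp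

lemma der_one [simp]:
  assumes D: "D \<in> derivations K A"
  shows "D \<one> = \<zero>"
proof -
  have "D \<one> \<oplus> D \<one> = D \<one>"
    using der_mult_arg[OF D, of \<one> \<one>] D by simp
  then show ?thesis using D by (metis A.add.r_cancel_one A.one_closed der_closed)
qed

lemma der_eqI:
  assumes "D \<in> derivations K A" "E \<in> derivations K A" "\<And>a. a \<in> carrier A \<Longrightarrow> D a = E a"
  shows "D = E"
  using assms derivations_memD(1) by (metis extensionalityI)

lemma der_smult_closed:
  assumes f: "f \<in> carrier A" and D: "D \<in> derivations K A"
  shows "(\<lambda>a\<in>carrier A. f \<otimes> D a) \<in> derivations K A"
proof -
  have "f \<otimes> D (a \<oplus> b) = f \<otimes> D a \<oplus> f \<otimes> D b"
    if "a \<in> carrier A" "b \<in> carrier A" for a b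
    using f D that by (simp add: der_add_arg A.r_distr)
  moreover have "f \<otimes> D (c \<odot> a) = c \<odot> (f \<otimes> D a)"
    if "c \<in> carrier K" "a \<in> carrier A" for c a
    using smult_assoc2[of c "D a" f] f D that by (simp add: der_smult_arg A.m_comm)
  moreover have "f \<otimes> D (a \<otimes> b) = a \<otimes> (f \<otimes> D b) \<oplus> (f \<otimes> D a) \<otimes> b"
    if "a \<in> carrier A" "b \<in> carrier A" for a b
    using f D that by (simp add: der_mult_arg A.r_distr A.m_assoc A.m_lcomm)
  ultimately show ?thesis
    using f D unfolding derivations_def by auto
qed

sublocale Der: module A "Der_module K A"
proof (rule moduleI)
  interpret L: lie_algebra K "Der K A"
    by (rule Der_is_lie_algebra) (rule algebra_axiom)
  show "abelian_group (Der_module K A)"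
  proof (rule abelian_groupI)
    fix D E F
    assume "D \<in> carrier (Der_module K A)" "E \<in> carrier (Der_module K A)"
      "F \<in> carrier (Der_module K A)"
    then show "D \<boxplus> E \<boxplus> F = D \<boxplus> (E \<boxplus> F)"
      using L.M.a_assoc[of D E F] by simp
  next
    fix D E
    assume *: "D \<in> carrier (Der_module K A)" "E \<in> carrier (Der_module K A)"
    then show "D \<boxplus> E \<in> carrier (Der_module K A)"
      using L.M.add.m_closed[of D E] by simp
    show "D \<boxplus> E = E \<boxplus> D"
      using * L.M.a_comm[of D E] by simp
  next
    show "\<zero>\<^bsub>Der_module K A\<^esub> \<in> carrier (Der_module K A)"
      using L.M.zero_closed by simp
  next
    fix D assume *: "D \<in> carrier (Der_module K A)"
    then show "\<zero>\<^bsub>Der_module K A\<^esub> \<boxplus> D = D"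
      using L.M.l_zero[of D] by simp
    show "\<exists>E\<in>carrier (Der_module K A). E \<boxplus> D = \<zero>\<^bsub>Der_module K A\<^esub>"
      using * L.M.l_neg[of D] L.M.a_inv_closed[of D] by auto
  qed
next
  fix D assume "D \<in> carrier (Der_module K A)"
  then show "\<one> \<Zspot> D = D"
    by (intro extensionalityI[where A = "carrier A"]) (auto simp: derivations_memD(1))
qed (auto simp: der_smult_closed A.l_distr A.r_distr A.m_assoc A.is_cring intro!: restrict_ext)

declare Der_module_simps(2-4) [simp del]

lemma der_module_closed [simp, intro]:
  "\<lbrakk>f \<in> carrier A; D \<in> derivations K A\<rbrakk> \<Longrightarrow> f \<Zspot> D \<in> derivations K A"
  "\<lbrakk>D \<in> derivations K A; E \<in> derivations K A\<rbrakk> \<Longrightarrow> D \<boxplus> E \<in> derivations K A"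
  "\<zero>\<^bsub>Der_module K A\<^esub> \<in> derivations K A"
  using Der.smult_closed[of f D] Der.M.add.m_closed[of D E] Der.M.zero_closed by simp_all

lemma der_module_apply [simp]:
  assumes "a \<in> carrier A"
  shows "(f \<Zspot> D) a = f \<otimes> D a" "(D \<boxplus> E) a = D a \<oplus> E a" "\<zero>\<^bsub>Der_module K A\<^esub> a = \<zero>"
  using assms by (simp_all add: Der_module_simps(2-4))

text \<open>
  The contraction of the symmetric product of \<open>D\<close> and \<open>E\<close> with the differential of \<open>a\<close>; hence bilinear over \<open>A\<close> in \<open>(D, E)\<close> and a derivation in \<open>a\<close>.
\<close>

definition symmetrized :: "('a \<Rightarrow> 'a) \<Rightarrow> ('a \<Rightarrow> 'a) \<Rightarrow> 'a \<Rightarrow> 'a \<Rightarrow> 'a" where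
  "symmetrized D E a = D a \<Zspot> E \<boxplus> E a \<Zspot> D"

lemma symmetrized_closed [simp, intro]:
  "\<lbrakk>D \<in> derivations K A; E \<in> derivations K A; a \<in> carrier A\<rbrakk> \<Longrightarrow>
   symmetrized D E a \<in> derivations K A"
  by (simp add: symmetrized_def)

lemma symmetrized_apply:
  "b \<in> carrier A \<Longrightarrow> symmetrized D E a b = D a \<otimes> E b \<oplus> E a \<otimes> D b"
  by (simp add: symmetrized_def)

lemma symmetrized_commute:
  assumes "D \<in> derivations K A" "E \<in> derivations K A" "a \<in> carrier A"
  shows "symmetrized D E a = symmetrized E D a"
  using assms by (intro der_eqI) (auto simp: symmetrized_apply A.a_comm)

lemma symmetrized_add_left:
  assumes "D \<in> derivations K A" "D' \<in> derivations K A" "E \<in> derivations K A" "a \<in> carrier A"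
  shows "symmetrized (D \<boxplus> D') E a = symmetrized D E a \<boxplus> symmetrized D' E a"
  using assms
  by (intro der_eqI) (auto simp: symmetrized_apply A.l_distr A.r_distr A.a_ac)

lemma symmetrized_smult_left:
  assumes "f \<in> carrier A" "D \<in> derivations K A" "E \<in> derivations K A" "a \<in> carrier A"
  shows "symmetrized (f \<Zspot> D) E a = f \<Zspot> symmetrized D E a"
  using assms
  by (intro der_eqI) (auto simp: symmetrized_apply A.r_distr A.m_ac)

lemma symmetrized_add_arg:
  assumes "D \<in> derivations K A" "E \<in> derivations K A" "a \<in> carrier A" "b \<in> carrier A"
  shows "symmetrized D E (a \<oplus> b) = symmetrized D E a \<boxplus> symmetrized D E b"
  using assms
  by (intro der_eqI) (auto simp: symmetrized_apply der_add_arg A.l_distr A.a_ac)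

lemma symmetrized_mult_arg:
  assumes "D \<in> derivations K A" "E \<in> derivations K A" "a \<in> carrier A" "b \<in> carrier A"
  shows "symmetrized D E (a \<otimes> b) = a \<Zspot> symmetrized D E b \<boxplus> b \<Zspot> symmetrized D E a"
  using assms
  by (intro der_eqI)
    (auto simp: symmetrized_apply der_mult_arg A.l_distr A.r_distr A.a_ac A.m_ac)

lemma symmetrized_smult_arg:
  assumes "D \<in> derivations K A" "E \<in> derivations K A" "c \<in> carrier K" "a \<in> carrier A"
  shows "symmetrized D E (c \<odot> a) = (c \<odot> \<one>) \<Zspot> symmetrized D E a"
  using assms
  by (intro der_eqI)
    (auto simp: symmetrized_apply der_smult_arg smult_assoc2 smult_r_distr)

lemma symmetrized_one:
  assumes "D \<in> derivations K A" "E \<in> derivations K A"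
  shows "symmetrized D E \<one> = \<zero>\<^bsub>Der_module K A\<^esub>"
  using assms by (intro der_eqI) (auto simp: symmetrized_apply)

end

text \<open>
  The map from the free module on \<open>G\<close> onto the differentials of \<open>A\<close> that sends \<open>x\<close> to \<open>dx\<close> is split
  by \<open>da \<mapsto> (B x a)\<^sub>x\<close>; the dual basis property is the dual of this splitting. The elements \<open>B x y\<close> are
  then the entries of an idempotent matrix and need not be \<open>0\<close> or \<open>1\<close>.
\<close>

locale derivation_basis = commutative_algebra A K
  for A :: "('k, 'a, 'm) module_scheme" (structure) and K :: "('k, 'n) ring_scheme" +
  fixes G :: "'a set" and B :: "'a \<Rightarrow> 'a \<Rightarrow> 'a"
  assumes finite_G: "finite G" and G_carrier: "G \<subseteq> carrier A"
    and generates: "unital_subalgebra K A hull G = carrier A"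
    and B_der: "x \<in> G \<Longrightarrow> B x \<in> derivations K A"
    and dual_basis: "\<lbrakk>E \<in> derivations K A; a \<in> carrier A\<rbrakk> \<Longrightarrow> E a = (\<Oplus>x\<in>G. B x a \<otimes> E x)"
begin

text \<open>
  Only the multiples of the basis that occur in the expansion of \<open>E\<close> are required to lie in \<open>N\<close>,
  because in the main application (\<open>E = B x\<close>, with \<open>N\<close> generated by multiples) the \<open>B y\<close> themselves
  are not known to lie in \<open>N\<close>.
\<close>

lemma in_submodule_by_basis:
  assumes N: "submodule N A (Der_module K A)" and E: "E \<in> derivations K A"
    and "\<And>x. x \<in> G \<Longrightarrow> E x \<Zspot> B x \<in> N"
  shows "E \<in> N"
proof -
  note N = Der.submodule_facts[OF N]
  have cl: "B x a \<otimes> E x \<in> carrier A" if "x \<in> G" "a \<in> carrier A" for x a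
    using that B_der G_carrier E by auto
  have "(\<lambda>a\<in>carrier A. \<Oplus>x\<in>T. B x a \<otimes> E x) \<in> N" if "T \<subseteq> G" for T
    using finite_subset[OF that finite_G] that
  proof (induction T rule: finite_induct)
    case empty
    show ?case using N(2) unfolding Der_module_simps(2) A.finsum_empty .
  next
    case (insert x T)
    then have x: "x \<in> G" by simp
    have "(\<Oplus>x\<in>insert x T. B x a \<otimes> E x) = E x \<otimes> B x a \<oplus> (\<Oplus>x\<in>T. B x a \<otimes> E x)"
      if "a \<in> carrier A" for a
    proof -
      have "(\<Oplus>x\<in>insert x T. B x a \<otimes> E x) = B x a \<otimes> E x \<oplus> (\<Oplus>x\<in>T. B x a \<otimes> E x)"
        using insert.hyps insert.prems that cl by (intro A.finsum_insert) auto
      moreover have "B x a \<otimes> E x = E x \<otimes> B x a"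
        using x that G_carrier B_der E by (intro A.m_comm) auto
      ultimately show ?thesis by simp
    qed
    then have "(\<lambda>a\<in>carrier A. \<Oplus>x\<in>insert x T. B x a \<otimes> E x)
        = E x \<Zspot> B x \<boxplus> (\<lambda>a\<in>carrier A. \<Oplus>x\<in>T. B x a \<otimes> E x)"
      unfolding Der_module_simps by (intro restrict_ext) (simp only: restrict_apply')
    moreover have "\<dots> \<in> N"
      using insert.prems by (intro N(3) assms(3)[OF x] insert.IH) simp
    ultimately show ?case by (simp only:)
  qed
  from this[of G] have "(\<lambda>a\<in>carrier A. \<Oplus>x\<in>G. B x a \<otimes> E x) \<in> N" by simp
  moreover have "(\<lambda>a\<in>carrier A. \<Oplus>x\<in>G. B x a \<otimes> E x) = E"
    using E dual_basis by (intro extensionalityI[where A = "carrier A"]) (auto simp: derivations_memD(1))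
  ultimately show ?thesis by simp
qed

lemma submodule_containing_basis:
  assumes "submodule N A (Der_module K A)" "\<And>x. x \<in> G \<Longrightarrow> B x \<in> N" "E \<in> derivations K A"
  shows "E \<in> N"
proof (rule in_submodule_by_basis[OF assms(1,3)])
  fix x assume x: "x \<in> G"
  then have "E x \<in> carrier A" using assms(3) G_carrier by auto
  then show "E x \<Zspot> B x \<in> N"
    by (rule Der.submodule_facts(4)[OF assms(1) _ assms(2)[OF x]])
qed

abbreviation symmetric_elements :: "('a \<Rightarrow> 'a) set" where
  "symmetric_elements \<equiv> {symmetrized (B x) (B y) z | x y z. x \<in> G \<and> y \<in> G \<and> z \<in> G}"

lemma symmetric_elements_der: "symmetric_elements \<subseteq> derivations K A"
  using B_der G_carrier by auto

text \<open>
  By multilinearity the finitely many \<open>\<sigma>(B x, B y, z)\<close> with \<open>x, y, z \<in> G\<close> span all \<open>\<sigma>(D, E, a)\<close>: the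
  Leibniz rule reduces \<open>a\<close> to \<open>G\<close>, and the dual basis reduces \<open>D\<close> and \<open>E\<close> one after the other.
\<close>

lemma symmetrized_in_span:
  assumes D: "D \<in> derivations K A" and E: "E \<in> derivations K A" and a: "a \<in> carrier A"
  shows "symmetrized D E a \<in> combinations (carrier A) (Der_module K A) symmetric_elements"
    (is "_ \<in> ?N")
proof -
  have sub: "submodule ?N A (Der_module K A)"
    by (rule Der.combinations_submodule) (use symmetric_elements_der in simp)
  note N = Der.submodule_facts[OF sub, unfolded Der_module_simps(1)]
  have basis: "symmetrized (B x) (B y) a \<in> ?N" if xy: "x \<in> G" "y \<in> G" and a: "a \<in> carrier A" for x y a
  proof -
    have cl: "B x \<in> derivations K A" "B y \<in> derivations K A" using xy B_der by auto
    show ?thesis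
      using generates a
    proof (induction rule: generated_induct)
      case carrier
      show ?case by (rule G_carrier)
    next
      case (generator z)
      then have "symmetrized (B x) (B y) z \<in> symmetric_elements" using xy by blast
      then show ?case
        by (intro Der.generator_in_combinations) (use symmetric_elements_der in auto)
    qed (auto simp: symmetrized_one symmetrized_add_arg symmetrized_mult_arg
          symmetrized_smult_arg cl intro!: N)
  qed
  have submodule_left: "submodule {D \<in> derivations K A. symmetrized D E a \<in> ?N} A (Der_module K A)"
    if "E \<in> derivations K A" for E
  proof (rule Der.submodule_by_closure)
    have "symmetrized \<zero>\<^bsub>Der_module K A\<^esub> E a = \<zero>\<^bsub>Der_module K A\<^esub>"
      using that a by (intro der_eqI) (auto simp: symmetrized_apply)
    then show "\<zero>\<^bsub>Der_module K A\<^esub> \<in> {D \<in> derivations K A. symmetrized D E a \<in> ?N}"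
      using N(2) by simp
  qed (use that a in \<open>auto simp: symmetrized_add_left symmetrized_smult_left intro!: N(3,4)\<close>)
  have "symmetrized D (B y) a \<in> ?N" if y: "y \<in> G" and D: "D \<in> derivations K A" for y D
    using submodule_containing_basis[OF submodule_left[OF B_der[OF y]] _ D] basis[OF _ y a] B_der
    by auto
  then have "symmetrized (B y) D a \<in> ?N" if "y \<in> G" for y
    using symmetrized_commute[OF B_der[OF that] D a] that D by simp
  then show ?thesis
    using submodule_containing_basis[OF submodule_left[OF D] _ E] B_der
      symmetrized_commute[OF D E a] symmetrized_commute[OF _ D a] by auto
qed

text \<open>
  From \<open>E(a) E \<in> N\<close>, with \<open>N\<close> the span, the element \<open>E(a)\<^sup>2\<close> maps every derivation \<open>D\<close> into \<open>N\<close>,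
  because modulo \<open>N\<close> the roles of \<open>E\<close> and \<open>D\<close> in \<open>E(a) D\<close> can be exchanged up to sign.
  Applied to the \<open>B x y\<close> this meets the covering argument.
\<close>

lemma derivations_symmetrically_spanned:
  assumes h: "h \<in> carrier K" "h \<otimes>\<^bsub>K\<^esub> (\<one>\<^bsub>K\<^esub> \<oplus>\<^bsub>K\<^esub> \<one>\<^bsub>K\<^esub>) = \<one>\<^bsub>K\<^esub>"
  shows "derivations K A \<subseteq> combinations (carrier A) (Der_module K A) symmetric_elements"
    (is "_ \<subseteq> ?N")
proof -
  have sub: "submodule ?N A (Der_module K A)"
    by (rule Der.combinations_submodule) (use symmetric_elements_der in simp)
  note N = Der.submodule_facts[OF sub, unfolded Der_module_simps(1)]
  have square: "E a \<Zspot> E \<in> ?N" if E: "E \<in> derivations K A" and a: "a \<in> carrier A" for E a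
  proof -
    have "h \<odot> (b \<oplus> b) = b" if "b \<in> carrier A" for b
    proof -
      have "b \<oplus> b = (\<one>\<^bsub>K\<^esub> \<oplus>\<^bsub>K\<^esub> \<one>\<^bsub>K\<^esub>) \<odot> b"
        using that by (simp add: smult_l_distr)
      then show ?thesis
        using that h by (simp add: smult_assoc1[symmetric])
    qed
    then have "E a \<Zspot> E = (h \<odot> \<one>) \<Zspot> symmetrized E E a"
      using E a h(1)
      by (intro der_eqI) (auto simp: symmetrized_apply smult_assoc2)
    moreover have "(h \<odot> \<one>) \<Zspot> symmetrized E E a \<in> ?N"
      using h(1) by (intro N(4) symmetrized_in_span[OF E E a]) simp
    ultimately show ?thesis by (simp only:)
  qed
  have squares: "(E a \<otimes> E a) \<Zspot> D \<in> ?N"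
    if E: "E \<in> derivations K A" and a: "a \<in> carrier A" and D: "D \<in> derivations K A" for E a D
  proof (rule Der.submodule_add_cancel[OF sub])
    show "D a \<Zspot> E a \<Zspot> E \<in> ?N"
      using D a by (intro N(4) square[OF E a]) simp
    have "E a \<Zspot> symmetrized E D a = (E a \<otimes> E a) \<Zspot> D \<boxplus> D a \<Zspot> E a \<Zspot> E"
      using E D a by (intro der_eqI) (auto simp: symmetrized_apply A.r_distr A.m_ac)
    moreover have "E a \<Zspot> symmetrized E D a \<in> ?N"
      using E a by (intro N(4) symmetrized_in_span[OF E D a]) simp
    ultimately show "(E a \<otimes> E a) \<Zspot> D \<boxplus> D a \<Zspot> E a \<Zspot> E \<in> ?N"
      by (simp only:)
  qed (use E D a in simp)
  define P where "P = (\<lambda>(x, y). B x y) ` (G \<times> G)"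
  let ?W = "?N \<union> {p \<Zspot> D | p D. p \<in> P \<and> D \<in> derivations K A}"
  have P: "finite P" "P \<subseteq> carrier A"
    using finite_G B_der G_carrier by (auto simp: P_def)
  have W: "?W \<subseteq> carrier (Der_module K A)"
    using N(1) P(2) by auto
  have sub_W: "submodule (combinations (carrier A) (Der_module K A) ?W) A (Der_module K A)"
    by (rule Der.combinations_submodule[OF W])
  have "B x \<in> combinations (carrier A) (Der_module K A) ?W" if x: "x \<in> G" for x
  proof (rule in_submodule_by_basis[OF sub_W B_der[OF x]])
    fix y assume y: "y \<in> G"
    then have "B x y \<in> P" using x by (auto simp: P_def)
    then have "B x y \<Zspot> B y \<in> ?W" using B_der[OF y] by blast
    then show "B x y \<Zspot> B y \<in> combinations (carrier A) (Der_module K A) ?W"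
      by (rule Der.generator_in_combinations[OF W])
  qed
  then have "derivations K A \<subseteq> combinations (carrier A) (Der_module K A) ?W"
    using submodule_containing_basis[OF sub_W] by blast
  then have "carrier (Der_module K A) \<subseteq> ?N"
    using squares B_der G_carrier
    by (intro Der.covered_by_square_multiples[OF P sub]) (auto simp: P_def)
  then show ?thesis by simp
qed

end


section \<open>Generating all derivations by brackets\<close>

lemma (in abelian_group) difference_rearrange:
  assumes "u \<in> carrier G" "v \<in> carrier G" "s \<in> carrier G" "t \<in> carrier G"
  shows "(v \<oplus> u) \<oplus> (s \<ominus> (t \<oplus> u)) = (s \<oplus> v) \<ominus> t"
proof -
  have "(v \<oplus> u) \<oplus> (s \<oplus> (\<ominus> t \<oplus> \<ominus> u)) = (s \<oplus> v \<oplus> \<ominus> t) \<oplus> (u \<oplus> \<ominus> u)"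
    using assms by (simp add: a_ac)
  then show ?thesis
    using assms by (simp add: minus_eq minus_add r_neg)
qed

context commutative_algebra
begin

sublocale Lie: lie_algebra K "Der K A"
  by (rule Der_is_lie_algebra) (rule algebra_axiom)

abbreviation der_bracket :: "('a \<Rightarrow> 'a) \<Rightarrow> ('a \<Rightarrow> 'a) \<Rightarrow> 'a \<Rightarrow> 'a" where
  "der_bracket \<equiv> lie_bracket (Der K A)"

lemma Der_add_eq: "ring.add (Der K A) = ring.add (Der_module K A)"
  by (simp add: Der_module_simps(3))

lemma Der_smult_eq:
  assumes "c \<in> carrier K" "D \<in> derivations K A"
  shows "c \<odot>\<^bsub>Der K A\<^esub> D = (c \<odot> \<one>) \<Zspot> D"
  unfolding Der_simps(4) Der_module_simps(4)
  using assms by (intro restrict_ext) (simp add: smult_assoc2)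

text \<open>
  The terms \<open>f z g [D, E]\<close> of the two brackets agree, and so do the terms with derivatives of \<open>f\<close>
  or \<open>g\<close>. The difference comes from the factor \<open>z\<close> alone, which \<open>D\<close> differentiates in
  one bracket and \<open>E\<close> in the other.
\<close>

lemma symmetrized_by_brackets:
  assumes fgz: "f \<in> carrier A" "g \<in> carrier A" "z \<in> carrier A"
    and D: "D \<in> derivations K A" and E: "E \<in> derivations K A"
  shows "(f \<otimes> g) \<Zspot> symmetrized D E z \<boxplus> der_bracket ((z \<otimes> f) \<Zspot> D) (g \<Zspot> E)
    = der_bracket (f \<Zspot> D) ((z \<otimes> g) \<Zspot> E)"
proof (rule der_eqI)
  have closed: "der_bracket D' E' \<in> derivations K A"
    if "D' \<in> derivations K A" "E' \<in> derivations K A" for D' E'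
    using Lie.bracket_closed[of D' E'] that by simp
  show "(f \<otimes> g) \<Zspot> symmetrized D E z \<boxplus> der_bracket ((z \<otimes> f) \<Zspot> D) (g \<Zspot> E) \<in> derivations K A"
    using assms by (intro der_module_closed closed symmetrized_closed) auto
  show "der_bracket (f \<Zspot> D) ((z \<otimes> g) \<Zspot> E) \<in> derivations K A"
    using assms by (intro der_module_closed closed) auto
  fix b assume b: "b \<in> carrier A"
  define s where "s = f \<otimes> z \<otimes> D g \<otimes> E b \<oplus> f \<otimes> z \<otimes> g \<otimes> D (E b)"
  define t where "t = z \<otimes> g \<otimes> E f \<otimes> D b \<oplus> z \<otimes> g \<otimes> f \<otimes> E (D b)"
  define u where "u = f \<otimes> g \<otimes> E z \<otimes> D b"
  define v where "v = f \<otimes> g \<otimes> D z \<otimes> E b"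
  have cl: "s \<in> carrier A" "t \<in> carrier A" "u \<in> carrier A" "v \<in> carrier A"
    using fgz b D E by (simp_all add: s_def t_def u_def v_def)
  have "((f \<otimes> g) \<Zspot> symmetrized D E z) b = v \<oplus> u"
    using fgz b D E by (simp add: symmetrized_apply u_def v_def A.r_distr A.m_assoc)
  moreover have "der_bracket ((z \<otimes> f) \<Zspot> D) (g \<Zspot> E) b = s \<ominus> (t \<oplus> u)"
  proof -
    have "((z \<otimes> f) \<Zspot> D) ((g \<Zspot> E) b) = s"
      using fgz b D E by (simp add: s_def der_mult_arg A.r_distr A.m_ac A.a_ac)
    moreover have "(g \<Zspot> E) (((z \<otimes> f) \<Zspot> D) b) = t \<oplus> u"
      using fgz b D E by (simp add: t_def u_def der_mult_arg A.r_distr A.l_distr A.m_ac A.a_ac)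
    ultimately show ?thesis using b by simp
  qed
  moreover have "der_bracket (f \<Zspot> D) ((z \<otimes> g) \<Zspot> E) b = (s \<oplus> v) \<ominus> t"
  proof -
    have "(f \<Zspot> D) (((z \<otimes> g) \<Zspot> E) b) = s \<oplus> v"
      using fgz b D E by (simp add: s_def v_def der_mult_arg A.r_distr A.l_distr A.m_ac A.a_ac)
    moreover have "((z \<otimes> g) \<Zspot> E) ((f \<Zspot> D) b) = t"
      using fgz b D E by (simp add: t_def der_mult_arg A.r_distr A.m_ac A.a_ac)
    ultimately show ?thesis using b by simp
  qed
  ultimately show "((f \<otimes> g) \<Zspot> symmetrized D E z \<boxplus> der_bracket ((z \<otimes> f) \<Zspot> D) (g \<Zspot> E)) b
      = der_bracket (f \<Zspot> D) ((z \<otimes> g) \<Zspot> E) b"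
    using A.difference_rearrange[OF cl(3,4,1,2)] b by (simp only: der_module_apply)
qed

text \<open>
  The operations of \<open>Der K A\<close> are expressed by those of the \<open>A\<close>-module, so that the computations
  below use only one notation.
\<close>

lemma lie_subalgebra_facts:
  assumes "lie_subalgebra K (Der K A) H"
  shows "H \<subseteq> derivations K A" "\<zero>\<^bsub>Der_module K A\<^esub> \<in> H"
    "\<And>D E. \<lbrakk>D \<in> H; E \<in> H\<rbrakk> \<Longrightarrow> D \<boxplus> E \<in> H"
    "\<And>c D. \<lbrakk>c \<in> carrier K; D \<in> H\<rbrakk> \<Longrightarrow> (c \<odot> \<one>) \<Zspot> D \<in> H"
    "\<And>D E. \<lbrakk>D \<in> H; E \<in> H\<rbrakk> \<Longrightarrow> der_bracket D E \<in> H"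
    "\<And>D E. \<lbrakk>D \<in> derivations K A; E \<in> H; D \<boxplus> E \<in> H\<rbrakk> \<Longrightarrow> D \<in> H"
proof -
  have sub: "submodule H K (Der K A)" using assms by (simp add: lie_subalgebra_def)
  note facts = Lie.submodule_facts[OF sub]
  show H: "H \<subseteq> derivations K A" using facts(1) by simp
  show "\<zero>\<^bsub>Der_module K A\<^esub> \<in> H"
    using facts(2) unfolding Der_simps(2) Der_module_simps(2) .
  show "D \<boxplus> E \<in> H" if "D \<in> H" "E \<in> H" for D E
    using facts(3)[OF that] unfolding Der_add_eq .
  show "(c \<odot> \<one>) \<Zspot> D \<in> H" if "c \<in> carrier K" "D \<in> H" for c D
    using facts(4)[OF that] H that by (simp only: Der_smult_eq subsetD)
  show "der_bracket D E \<in> H" if "D \<in> H" "E \<in> H" for D E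
    using assms that unfolding lie_subalgebra_def by blast
  show "D \<in> H" if "D \<in> derivations K A" "E \<in> H" "D \<boxplus> E \<in> H" for D E
    using Lie.submodule_add_cancel[OF sub _ that(2)] that unfolding Der_add_eq by simp
qed

end

context derivation_basis
begin

text \<open>
  Induction on the length \<open>n\<close> of the word. After a letter \<open>f \<in> F\<close> is added, the word is cut
  after three letters. The pieces have lengths \<open>3\<close> and \<open>n - 2\<close>, and with one more letter \<open>z\<close> they
  have lengths \<open>4\<close> and \<open>n - 1\<close>; all are below \<open>n\<close> as soon as \<open>n > 4\<close>.
\<close>

lemma monomial_multiples_in_subalgebra:
  assumes H: "lie_subalgebra K (Der K A) H"
    and Y: "G \<subseteq> Y" "F \<subseteq> Y" "Y \<subseteq> carrier A"
    and span: "\<And>x. x \<in> G \<Longrightarrow> B x \<in> combinations F (Der_module K A) symmetric_elements"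
    and short: "\<And>ws x. \<lbrakk>ws \<in> lists Y; length ws \<le> 4; x \<in> G\<rbrakk> \<Longrightarrow> monomial A ws \<Zspot> B x \<in> H"
    and "ws \<in> lists Y" "x \<in> G"
  shows "monomial A ws \<Zspot> B x \<in> H"
  using assms(7,8)
proof (induction ws arbitrary: x rule: length_induct)
  case (1 ws)
  note H = lie_subalgebra_facts[OF H]
  have lists: "us \<in> lists (carrier A)" if "us \<in> lists Y" for us
    using that Y(3) by auto
  have IH: "monomial A us \<Zspot> B y \<in> H"
    if "length us < length ws" "us \<in> lists Y" "y \<in> G" for us y
    using 1(1) that by blast
  show ?case
  proof (cases "length ws \<le> 4")
    case True
    then show ?thesis using short 1(2,3) by blast
  next
    case False
    have mws: "monomial A ws \<in> carrier A" using 1(2) lists by simp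
    have step: "(monomial A ws \<otimes> f) \<Zspot> symmetrized (B y) (B y') z \<in> H"
      if f: "f \<in> F" and yz: "y \<in> G" "y' \<in> G" "z \<in> G" for f y y' z
    proof -
      \<comment> \<open>Commuting \<open>f\<close> to the front makes \<open>w f\<close> a word again, so that it can be cut anywhere.\<close>
      define us vs where "us = take 3 (f # ws)" and "vs = drop 3 (f # ws)"
      have fws: "f # ws \<in> lists Y" using f Y(2) 1(2) by auto
      then have uv: "us \<in> lists Y" "vs \<in> lists Y"
        unfolding us_def vs_def by (auto dest: in_set_takeD in_set_dropD)
      then have zuv: "z # us \<in> lists Y" "z # vs \<in> lists Y" using yz(3) Y(1) by auto
      have len: "length us < length ws" "length vs < length ws"
        "length (z # us) < length ws" "length (z # vs) < length ws"
        using False by (auto simp: us_def vs_def)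
      have cl: "monomial A us \<in> carrier A" "monomial A vs \<in> carrier A" "z \<in> carrier A"
        "f \<in> carrier A"
        using uv lists yz(3) G_carrier f Y by auto
      have "monomial A ws \<otimes> f = monomial A (f # ws)"
        using cl(4) mws by (simp add: A.m_comm)
      also have "\<dots> = monomial A us \<otimes> monomial A vs"
        using monomial_append[OF lists[OF uv(1)] lists[OF uv(2)]]
        by (simp only: us_def vs_def append_take_drop_id)
      finally have split: "monomial A ws \<otimes> f = monomial A us \<otimes> monomial A vs" .
      show ?thesis
        unfolding split
      proof (rule H(6))
        show "(monomial A us \<otimes> monomial A vs) \<Zspot> symmetrized (B y) (B y') z \<in> derivations K A"
          using cl yz B_der by (intro der_module_closed symmetrized_closed) auto
        show "der_bracket ((z \<otimes> monomial A us) \<Zspot> B y) (monomial A vs \<Zspot> B y') \<in> H"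
          using H(5)[OF IH[OF len(3) zuv(1) yz(1)] IH[OF len(2) uv(2) yz(2)]]
          by (simp only: monomial_simps)
        show "(monomial A us \<otimes> monomial A vs) \<Zspot> symmetrized (B y) (B y') z \<boxplus>
            der_bracket ((z \<otimes> monomial A us) \<Zspot> B y) (monomial A vs \<Zspot> B y') \<in> H"
          unfolding symmetrized_by_brackets[OF cl(1-3) B_der[OF yz(1)] B_der[OF yz(2)]]
          using H(5)[OF IH[OF len(1) uv(1) yz(1)] IH[OF len(4) zuv(2) yz(2)]]
          by (simp only: monomial_simps)
      qed
    qed
    have "monomial A ws \<Zspot> v \<in> H"
      if "v \<in> combinations F (Der_module K A) symmetric_elements" for v
      using that
    proof induction
      case zero
      show ?case using H(2) Der.smult_r_null[OF mws] by (simp only:)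
    next
      case (add f w v)
      have f: "f \<in> carrier A" using add(1) Y by blast
      have w: "w \<in> derivations K A" using add(2) symmetric_elements_der by blast
      have "v \<in> derivations K A"
        using Der.combinations_carrier[OF _ _ add(3)] Y symmetric_elements_der by auto
      then have "monomial A ws \<Zspot> (f \<Zspot> w \<boxplus> v) = (monomial A ws \<otimes> f) \<Zspot> w \<boxplus> monomial A ws \<Zspot> v"
        using Der.smult_r_distr[of "monomial A ws" "f \<Zspot> w" v] Der.smult_assoc1[of "monomial A ws" f w]
          mws f w by simp
      moreover have "(monomial A ws \<otimes> f) \<Zspot> w \<in> H"
        using step add(1,2) by blast
      ultimately show ?case using H(3)[OF _ add(4)] by (simp only:)
    qed
    then show ?thesis using span 1(3) by blast
  qed
qed

text \<open>
  A Lie subalgebra that contains the generators contains all \<open>w B x\<close> with \<open>w\<close> a monomial, hence by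
  linearity over \<open>K\<close> all \<open>a B x\<close> with \<open>a \<in> A\<close>, and these span.
\<close>

lemma derivations_finitely_generated:
  assumes h: "h \<in> carrier K" "h \<otimes>\<^bsub>K\<^esub> (\<one>\<^bsub>K\<^esub> \<oplus>\<^bsub>K\<^esub> \<one>\<^bsub>K\<^esub>) = \<one>\<^bsub>K\<^esub>"
  shows "finitely_generated_lie_algebra K (Der K A)"
proof -
  obtain F where F: "finite F" "F \<subseteq> carrier A"
    and span: "\<forall>x\<in>G. B x \<in> combinations F (Der_module K A) symmetric_elements"
    using combinations_family_finitary[OF finite_G, of B "carrier A" "Der_module K A" symmetric_elements]
      derivations_symmetrically_spanned[OF h] B_der by blast
  define Y where "Y = G \<union> F"
  have Y: "finite Y" "G \<subseteq> Y" "F \<subseteq> Y" "Y \<subseteq> carrier A"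
    using finite_G F G_carrier by (auto simp: Y_def)
  define S where "S = (\<lambda>(ws, x). monomial A ws \<Zspot> B x) ` ({ws \<in> lists Y. length ws \<le> 4} \<times> G)"
  have "finite {ws \<in> lists Y. length ws \<le> 4}"
    using finite_lists_length_le[OF Y(1), of 4] by (simp add: lists_eq_set conj_commute)
  then have finite_S: "finite S" using finite_G by (simp add: S_def)
  have S_der: "S \<subseteq> derivations K A"
  proof
    fix D assume "D \<in> S"
    then obtain ws x where D: "D = monomial A ws \<Zspot> B x" "ws \<in> lists Y" "x \<in> G"
      by (auto simp: S_def)
    moreover from this have "ws \<in> lists (carrier A)" using Y(4) by auto
    ultimately show "D \<in> derivations K A"
      using B_der by auto
  qed
  have all: "derivations K A \<subseteq> H" if H: "lie_subalgebra K (Der K A) H" and S: "S \<subseteq> H" for H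
  proof
    fix E assume E: "E \<in> derivations K A"
    note Hf = lie_subalgebra_facts[OF H]
    have short: "monomial A ws \<Zspot> B x \<in> H"
      if "ws \<in> lists Y" "length ws \<le> 4" "x \<in> G" for ws x
      using S that by (force simp: S_def)
    have W: "monomial A ` lists G \<subseteq> carrier A"
      using lists_mono[OF G_carrier] monomial_closed by (intro image_subsetI) blast
    have multiples: "a \<Zspot> B x \<in> H" if a: "a \<in> carrier A" and x: "x \<in> G" for a x
      using combinations_of_monomials[OF generates G_carrier a]
    proof induction
      case zero
      show ?case using Hf(2) Der.smult_l_null[of "B x"] B_der[OF x] by simp
    next
      case (add c w a)
      have cl: "w \<in> carrier A" "a \<in> carrier A"
        using add(2) W combinations_carrier[OF subset_refl W add(3)] by auto
      have "(c \<odot> w \<oplus> a) \<Zspot> B x = (c \<odot> \<one>) \<Zspot> w \<Zspot> B x \<boxplus> a \<Zspot> B x"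
        using cl add(1) B_der[OF x]
        by (intro der_eqI) (auto simp: A.l_distr smult_assoc2)
      moreover have "w \<Zspot> B x \<in> H"
        using add(2) monomial_multiples_in_subalgebra[OF H Y(2-4) _ short _ x] span Y(2) by auto
      ultimately show ?case
        using Hf(3)[OF Hf(4)[OF add(1)] add(4)] by (simp only:)
    qed
    \<comment> \<open>\<open>H\<close> is not an \<open>A\<close>-module, but the largest \<open>A\<close>-module inside it contains the basis.\<close>
    have "submodule {E \<in> derivations K A. \<forall>a\<in>carrier A. a \<Zspot> E \<in> H} A (Der_module K A)"
    proof (rule Der.submodule_by_closure)
      fix b E assume b: "b \<in> carrier A" and E: "E \<in> {E \<in> derivations K A. \<forall>a\<in>carrier A. a \<Zspot> E \<in> H}"
      then have "a \<Zspot> b \<Zspot> E = (a \<otimes> b) \<Zspot> E" if "a \<in> carrier A" for a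
        using Der.smult_assoc1[of a b E] that by simp
      then show "b \<Zspot> E \<in> {E \<in> derivations K A. \<forall>a\<in>carrier A. a \<Zspot> E \<in> H}"
        using b E by auto
    qed (use Hf(2,3) Der.smult_r_distr in auto)
    then have "E \<in> {E \<in> derivations K A. \<forall>a\<in>carrier A. a \<Zspot> E \<in> H}"
      by (rule submodule_containing_basis) (use multiples B_der E in auto)
    then show "E \<in> H"
      using Der.smult_one[of E] E A.one_closed by (metis (no_types, lifting) Der_module_simps(1) mem_Collect_eq)
  qed
  have "lie_subalgebra K (Der K A) (derivations K A)"
    using Lie.carrier_is_submodule Lie.bracket_closed by (simp add: lie_subalgebra_def)
  then have "lie_subalgebra K (Der K A) hull S = derivations K A"
    using S_der all by (intro hull_unique) auto
  then show ?thesis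
    unfolding finitely_generated_lie_algebra_def
    using finite_S S_der Lie.lie_algebra_axioms by auto
qed

end


section \<open>Sections of square-zero extensions\<close>

lemma algebra_homI:
  assumes "\<And>a. a \<in> carrier A \<Longrightarrow> f a \<in> carrier B"
    and "\<And>a b. \<lbrakk>a \<in> carrier A; b \<in> carrier A\<rbrakk> \<Longrightarrow> f (a \<otimes>\<^bsub>A\<^esub> b) = f a \<otimes>\<^bsub>B\<^esub> f b"
    and "\<And>a b. \<lbrakk>a \<in> carrier A; b \<in> carrier A\<rbrakk> \<Longrightarrow> f (a \<oplus>\<^bsub>A\<^esub> b) = f a \<oplus>\<^bsub>B\<^esub> f b"
    and "f \<one>\<^bsub>A\<^esub> = \<one>\<^bsub>B\<^esub>"
    and "\<And>c a. \<lbrakk>c \<in> carrier K; a \<in> carrier A\<rbrakk> \<Longrightarrow> f (c \<odot>\<^bsub>A\<^esub> a) = c \<odot>\<^bsub>B\<^esub> f a"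
  shows "f \<in> algebra_hom K A B"
  using assms by (auto simp: algebra_hom_def intro: ring_hom_memI)

lemma algebra_homD:
  assumes "f \<in> algebra_hom K A B"
  shows "a \<in> carrier A \<Longrightarrow> f a \<in> carrier B"
    and "\<lbrakk>a \<in> carrier A; b \<in> carrier A\<rbrakk> \<Longrightarrow> f (a \<otimes>\<^bsub>A\<^esub> b) = f a \<otimes>\<^bsub>B\<^esub> f b"
    and "\<lbrakk>a \<in> carrier A; b \<in> carrier A\<rbrakk> \<Longrightarrow> f (a \<oplus>\<^bsub>A\<^esub> b) = f a \<oplus>\<^bsub>B\<^esub> f b"
    and "f \<one>\<^bsub>A\<^esub> = \<one>\<^bsub>B\<^esub>"
    and "\<lbrakk>c \<in> carrier K; a \<in> carrier A\<rbrakk> \<Longrightarrow> f (c \<odot>\<^bsub>A\<^esub> a) = c \<odot>\<^bsub>B\<^esub> f a"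
  using assms by (auto simp: algebra_hom_def ring_hom_closed ring_hom_mult ring_hom_add ring_hom_one)

text \<open>
  The lifting property is applied to the inverse of the isomorphism of \<open>R/I\<close> with \<open>A\<close>, where \<open>I\<close> is
  the kernel of \<open>q\<close>: it sends \<open>a\<close> to its fibre.
\<close>

lemma section_of_square_zero_extension:
  fixes R :: "('k, 'r) module"
  assumes smooth: "formally_smooth TYPE('r) K A"
    and A: "algebra K A" and R: "algebra K R"
    and q: "q \<in> algebra_hom K R A" and surj: "q ` carrier R = carrier A"
    and square_zero: "\<And>r t. \<lbrakk>r \<in> carrier R; t \<in> carrier R; q r = \<zero>\<^bsub>A\<^esub>; q t = \<zero>\<^bsub>A\<^esub>\<rbrakk> \<Longrightarrow>
      r \<otimes>\<^bsub>R\<^esub> t = \<zero>\<^bsub>R\<^esub>"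
  shows "\<exists>s\<in>algebra_hom K A R. \<forall>a\<in>carrier A. q (s a) = a"
proof -
  interpret A: commutative_algebra A K
    using A algebra.M_cring by (simp add: commutative_algebra_def)
  interpret R: commutative_algebra R K
    using R algebra.M_cring by (simp add: commutative_algebra_def)
  interpret q: ring_hom_ring R A q
    using q by (intro ring_hom_ringI2) (auto simp: algebra_hom_def R.A.ring_axioms A.A.ring_axioms)
  define I where "I = a_kernel R A q"
  interpret I: ideal I R
    unfolding I_def by (rule q.kernel_is_ideal)
  have I_iff: "r \<in> I \<longleftrightarrow> r \<in> carrier R \<and> q r = \<zero>\<^bsub>A\<^esub>" for r
    unfolding I_def a_kernel_def' by blast
  define u where "u a = {r \<in> carrier R. q r = a}" for a
  have u: "u (q r) = I +>\<^bsub>R\<^esub> r" if "r \<in> carrier R" for r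
    unfolding u_def I_def by (rule q.rcos_eq_homeq[OF that, symmetric])
  have u_hom: "u \<in> algebra_hom K A (quot_algebra R I)"
  proof -
    have pre: "\<exists>r\<in>carrier R. q r = a" if "a \<in> carrier A" for a
      using that unfolding surj[symmetric] image_iff by blast
    have mult: "u (q (r \<otimes>\<^bsub>R\<^esub> t)) = u (q r) \<otimes>\<^bsub>R Quot I\<^esub> u (q t)"
      if "r \<in> carrier R" "t \<in> carrier R" for r t
      using that I.rcoset_mult_add by (simp add: u FactRing_def del: q.hom_mult)
    have add: "u (q (r \<oplus>\<^bsub>R\<^esub> t)) = u (q r) \<oplus>\<^bsub>R Quot I\<^esub> u (q t)"
      if "r \<in> carrier R" "t \<in> carrier R" for r t
      using that I.a_rcos_sum by (simp add: u FactRing_def del: q.hom_add)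
    have smult: "u (q (c \<odot>\<^bsub>R\<^esub> r)) = c \<odot>\<^bsub>quot_algebra R I\<^esub> u (q r)"
      if "c \<in> carrier K" "r \<in> carrier R" for c r
      using that quot_algebra_smult[OF R I.ideal_axioms that] by (simp only: u R.smult_closed)
    show ?thesis
    proof (rule algebra_homI)
      fix a b assume ab: "a \<in> carrier A" "b \<in> carrier A"
      obtain r where r: "r \<in> carrier R" "q r = a" using pre[OF ab(1)] by (rule bexE)
      obtain t where t: "t \<in> carrier R" "q t = b" using pre[OF ab(2)] by (rule bexE)
      show "u (a \<otimes>\<^bsub>A\<^esub> b) = u a \<otimes>\<^bsub>quot_algebra R I\<^esub> u b"
        using mult[OF r(1) t(1)] algebra_homD(2)[OF q r(1) t(1)] r(2) t(2) by simp
      show "u (a \<oplus>\<^bsub>A\<^esub> b) = u a \<oplus>\<^bsub>quot_algebra R I\<^esub> u b"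
        using add[OF r(1) t(1)] algebra_homD(3)[OF q r(1) t(1)] r(2) t(2) by simp
    next
      fix a assume a: "a \<in> carrier A"
      obtain r where r: "r \<in> carrier R" "q r = a" using pre[OF a] by (rule bexE)
      show "u a \<in> carrier (quot_algebra R I)"
        using u[OF r(1)] r by (auto simp: FactRing_def A_RCOSETS_def')
      show "u (c \<odot>\<^bsub>A\<^esub> a) = c \<odot>\<^bsub>quot_algebra R I\<^esub> u a" if "c \<in> carrier K" for c
        using smult[OF that r(1)] algebra_homD(5)[OF q that r(1)] r(2) by (simp only:)
    next
      show "u \<one>\<^bsub>A\<^esub> = \<one>\<^bsub>quot_algebra R I\<^esub>"
        using u[OF R.A.one_closed] by (simp add: FactRing_def)
    qed
  qed
  have "ideal_prod R I I = {\<zero>\<^bsub>R\<^esub>}"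
  proof
    show "ideal_prod R I I \<subseteq> {\<zero>\<^bsub>R\<^esub>}"
    proof
      fix r assume "r \<in> ideal_prod R I I"
      then show "r \<in> {\<zero>\<^bsub>R\<^esub>}"
        by induction (auto simp: I_iff square_zero)
    qed
    show "{\<zero>\<^bsub>R\<^esub>} \<subseteq> ideal_prod R I I"
      using ideal_prod.prod[of "\<zero>\<^bsub>R\<^esub>" I "\<zero>\<^bsub>R\<^esub>" I R] by (simp add: I.additive_subgroup_axioms additive_subgroup.zero_closed)
  qed
  then obtain v where v: "v \<in> algebra_hom K A R" "\<And>a. a \<in> carrier A \<Longrightarrow> I +>\<^bsub>R\<^esub> v a = u a"
    using smooth R I.ideal_axioms u_hom unfolding formally_smooth_def by blast
  have "q (v a) = a" if "a \<in> carrier A" for a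
    using I.a_rcos_self[OF algebra_homD(1)[OF v(1) that]] v(2)[OF that] by (simp add: u_def)
  then show ?thesis using v(1) by blast
qed

definition transported_algebra ::
  "('b \<Rightarrow> 'r) \<Rightarrow> ('k, 'b, 'm) module_scheme \<Rightarrow> ('k, 'r) module" where
  "transported_algebra \<iota> R = (let \<pi> = inv_into (carrier R) \<iota> in
     \<lparr>carrier = \<iota> ` carrier R,
      monoid.mult = (\<lambda>x y. \<iota> (\<pi> x \<otimes>\<^bsub>R\<^esub> \<pi> y)),
      monoid.one = \<iota> \<one>\<^bsub>R\<^esub>,
      ring.zero = \<iota> \<zero>\<^bsub>R\<^esub>,
      ring.add = (\<lambda>x y. \<iota> (\<pi> x \<oplus>\<^bsub>R\<^esub> \<pi> y)),
      module.smult = (\<lambda>c x. \<iota> (c \<odot>\<^bsub>R\<^esub> \<pi> x))\<rparr>)"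

lemma transported_algebra:
  assumes R: "algebra K R" and inj: "inj_on \<iota> (carrier R)"
  shows "algebra K (transported_algebra \<iota> R)"
    and "inv_into (carrier R) \<iota> \<in> algebra_hom K (transported_algebra \<iota> R) R"
proof -
  interpret R: commutative_algebra R K
    using R algebra.M_cring by (simp add: commutative_algebra_def)
  note [simp] = transported_algebra_def Let_def inv_into_f_f[OF inj]
  have "cring (transported_algebra \<iota> R)"
  proof (rule cringI)
    show "abelian_group (transported_algebra \<iota> R)"
    proof (rule abelian_groupI)
      fix x assume "x \<in> carrier (transported_algebra \<iota> R)"
      then obtain r where "r \<in> carrier R" "x = \<iota> r" by auto
      then show "\<exists>y\<in>carrier (transported_algebra \<iota> R).
          y \<oplus>\<^bsub>transported_algebra \<iota> R\<^esub> x = \<zero>\<^bsub>transported_algebra \<iota> R\<^esub>"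
        by (intro bexI[of _ "\<iota> (\<ominus>\<^bsub>R\<^esub> r)"]) (auto simp: R.A.l_neg)
    qed (auto simp: R.A.a_ac)
    show "comm_monoid (transported_algebra \<iota> R)"
      by (rule comm_monoidI) (auto simp: R.A.m_ac)
  qed (auto simp: R.A.l_distr)
  then show "algebra K (transported_algebra \<iota> R)"
    by (rule algebraI[OF R.R_cring])
      (auto simp: R.smult_l_distr R.smult_r_distr R.smult_assoc1 R.smult_assoc2)
  show "inv_into (carrier R) \<iota> \<in> algebra_hom K (transported_algebra \<iota> R) R"
    by (rule algebra_homI) auto
qed

lemma algebra_hom_comp:
  assumes "f \<in> algebra_hom K A B" "g \<in> algebra_hom K B C"
  shows "g \<circ> f \<in> algebra_hom K A C"
  by (rule algebra_homI) (simp_all add: algebra_homD[OF assms(1)] algebra_homD[OF assms(2)])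

text \<open>
  An injection of the underlying set is enough, since the algebra structure can be transported
  along it.
\<close>

lemma section_of_embedded_square_zero_extension:
  fixes R :: "('k, 'b) module" and \<iota> :: "'b \<Rightarrow> 'r"
  assumes smooth: "formally_smooth TYPE('r) K A"
    and A: "algebra K A" and R: "algebra K R" and inj: "inj_on \<iota> (carrier R)"
    and q: "q \<in> algebra_hom K R A" and surj: "q ` carrier R = carrier A"
    and square_zero: "\<And>r t. \<lbrakk>r \<in> carrier R; t \<in> carrier R; q r = \<zero>\<^bsub>A\<^esub>; q t = \<zero>\<^bsub>A\<^esub>\<rbrakk> \<Longrightarrow>
      r \<otimes>\<^bsub>R\<^esub> t = \<zero>\<^bsub>R\<^esub>"
  shows "\<exists>s\<in>algebra_hom K A R. \<forall>a\<in>carrier A. q (s a) = a"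
proof -
  let ?T = "transported_algebra \<iota> R"
  let ?\<pi> = "inv_into (carrier R) \<iota>"
  note T = transported_algebra[OF R inj]
  have carrier_T: "carrier ?T = \<iota> ` carrier R"
    by (simp add: transported_algebra_def Let_def)
  have "\<exists>s\<in>algebra_hom K A ?T. \<forall>a\<in>carrier A. (q \<circ> ?\<pi>) (s a) = a"
  proof (rule section_of_square_zero_extension[OF smooth A T(1) algebra_hom_comp[OF T(2) q]])
    show "(q \<circ> ?\<pi>) ` carrier ?T = carrier A"
      using surj by (simp add: carrier_T image_comp inv_into_f_f[OF inj] cong: image_cong_simp)
    fix x y assume "x \<in> carrier ?T" "y \<in> carrier ?T" "(q \<circ> ?\<pi>) x = \<zero>\<^bsub>A\<^esub>" "(q \<circ> ?\<pi>) y = \<zero>\<^bsub>A\<^esub>"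
    then show "x \<otimes>\<^bsub>?T\<^esub> y = \<zero>\<^bsub>?T\<^esub>"
      using square_zero by (auto simp: transported_algebra_def Let_def inv_into_f_f[OF inj])
  qed
  then obtain s where "s \<in> algebra_hom K A ?T" "\<forall>a\<in>carrier A. (q \<circ> ?\<pi>) (s a) = a"
    by blast
  then show ?thesis
    using algebra_hom_comp[OF _ T(2)] by (intro bexI[of _ "?\<pi> \<circ> s"]) auto
qed

context commutative_algebra
begin

text \<open>
  An element of \<open>A\<close> is coded by its coefficients on the countable set of monomials in \<open>G\<close>, and a pair
  by finitely many such functions, that is by one function on a countable set. Multisets of natural
  numbers serve as a countable index set through their sizes.
\<close>

lemma embedding_into_coefficient_functions:
  assumes G: "finite G" "G \<subseteq> carrier A" and generates: "unital_subalgebra K A hull G = carrier A"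
  shows "\<exists>\<iota> :: 'a \<times> ('a \<Rightarrow> 'a) \<Rightarrow> (nat multiset \<Rightarrow> 'k) set.
    inj_on \<iota> (carrier A \<times> (G \<rightarrow>\<^sub>E carrier A))"
proof -
  define W where "W = monomial A ` lists G"
  have W: "W \<subseteq> carrier A"
    unfolding W_def using lists_mono[OF G(2)] monomial_closed by (intro image_subsetI) blast
  have "countable W" "W \<noteq> {}"
    using countable_finite[OF G(1)] by (auto simp: W_def)
  have "\<forall>a\<in>carrier A. \<exists>c. c \<in> W \<rightarrow> carrier K \<and> a = (\<Oplus>w\<in>{w \<in> W. c w \<noteq> \<zero>\<^bsub>K\<^esub>}. c w \<odot> w)"
    using combinations_finsum[OF W] combinations_of_monomials[OF generates G(2)]
    unfolding W_def by blast
  then obtain c where c_K: "\<And>a. a \<in> carrier A \<Longrightarrow> c a \<in> W \<rightarrow> carrier K"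
    and c: "\<And>a. a \<in> carrier A \<Longrightarrow> a = (\<Oplus>w\<in>{w \<in> W. c a w \<noteq> \<zero>\<^bsub>K\<^esub>}. c a w \<odot> w)"
    by (auto dest!: bchoice)
  have c_inj: "a = a'" if a: "a \<in> carrier A" "a' \<in> carrier A" and eq: "\<And>w. w \<in> W \<Longrightarrow> c a w = c a' w"
    for a a'
  proof -
    have "a = (\<Oplus>w\<in>{w \<in> W. c a w \<noteq> \<zero>\<^bsub>K\<^esub>}. c a w \<odot> w)"
      by (rule c[OF a(1)])
    also have "\<dots> = (\<Oplus>w\<in>{w \<in> W. c a' w \<noteq> \<zero>\<^bsub>K\<^esub>}. c a' w \<odot> w)"
    proof (rule A.finsum_cong')
      show "(\<lambda>w. c a' w \<odot> w) \<in> {w \<in> W. c a' w \<noteq> \<zero>\<^bsub>K\<^esub>} \<rightarrow> carrier A"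
        using c_K[OF a(2)] W by (intro Pi_I smult_closed) auto
    qed (use eq in auto)
    also have "\<dots> = a'"
      by (rule c[OF a(2), symmetric])
    finally show ?thesis .
  qed
  define Z where "Z = insert None (Some ` G) \<times> W"
  have Z: "countable Z" "Z \<noteq> {}"
    using \<open>countable W\<close> \<open>W \<noteq> {}\<close> countable_finite[OF G(1)] by (auto simp: Z_def)
  \<comment> \<open>The index \<open>None\<close> stands for the first component, \<open>Some x\<close> for the entry at \<open>x\<close>.\<close>
  define code where "code a b m = (case from_nat_into Z (size m) of
      (i, w) \<Rightarrow> c (case i of None \<Rightarrow> a | Some x \<Rightarrow> b x) w)" for a b and m :: "nat multiset"
  have code: "\<exists>m. \<forall>a b. code a b m = c (case i of None \<Rightarrow> a | Some x \<Rightarrow> b x) w"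
    if iw: "(i, w) \<in> Z" for i w
  proof -
    obtain n where "from_nat_into Z n = (i, w)"
      using from_nat_into_surj[OF Z(1) iw] by blast
    then have "\<forall>a b. code a b (replicate_mset n 0) = c (case i of None \<Rightarrow> a | Some x \<Rightarrow> b x) w"
      by (simp add: code_def)
    then show ?thesis by blast
  qed
  have "inj_on (\<lambda>(a, b). {code a b}) (carrier A \<times> (G \<rightarrow>\<^sub>E carrier A))"
  proof (rule inj_onI, clarify)
    fix a b a' b'
    assume a: "a \<in> carrier A" "a' \<in> carrier A"
      and b: "b \<in> G \<rightarrow>\<^sub>E carrier A" "b' \<in> G \<rightarrow>\<^sub>E carrier A"
      and same: "code a b = code a' b'"
    have eq: "c (case i of None \<Rightarrow> a | Some x \<Rightarrow> b x) w = c (case i of None \<Rightarrow> a' | Some x \<Rightarrow> b' x) w"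
      if "(i, w) \<in> Z" for i w
    proof -
      obtain m where "\<forall>a b. code a b m = c (case i of None \<Rightarrow> a | Some x \<Rightarrow> b x) w"
        using code[OF \<open>(i, w) \<in> Z\<close>] by blast
      then show ?thesis using same by metis
    qed
    have "a = a'"
      using eq[of None] by (intro c_inj[OF a]) (simp add: Z_def)
    moreover have "b x = b' x" if x: "x \<in> G" for x
      using eq[of "Some x"] x b by (intro c_inj) (auto simp: Z_def)
    then have "b = b'"
      by (rule PiE_ext[OF b])
    ultimately show "a = a' \<and> b = b'" by simp
  qed
  then show ?thesis by blast
qed

end


section \<open>Derivations of a smooth algebra\<close>

text \<open>
  A subalgebra of the trivial extension of \<open>A\<close> by the free module on \<open>G\<close>. The condition on the
  derivations makes every section of it a dual basis. It holds for the pair of a generator \<open>y\<close> and the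
  unit vector at \<open>y\<close>, and it is preserved by the operations because each side of it is a derivation
  along the first projection.
\<close>

definition derivation_extension ::
  "('k, 'n) ring_scheme \<Rightarrow> ('k, 'a, 'm) module_scheme \<Rightarrow> 'a set \<Rightarrow> ('k, 'a \<times> ('a \<Rightarrow> 'a)) module" where
  "derivation_extension K A G =
     \<lparr>carrier = {(a, b). a \<in> carrier A \<and> b \<in> G \<rightarrow>\<^sub>E carrier A \<and>
        (\<forall>E\<in>derivations K A. E a = (\<Oplus>\<^bsub>A\<^esub>x\<in>G. b x \<otimes>\<^bsub>A\<^esub> E x))},
      monoid.mult = (\<lambda>(a, b) (a', b'). (a \<otimes>\<^bsub>A\<^esub> a', \<lambda>x\<in>G. a \<otimes>\<^bsub>A\<^esub> b' x \<oplus>\<^bsub>A\<^esub> a' \<otimes>\<^bsub>A\<^esub> b x)),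
      monoid.one = (\<one>\<^bsub>A\<^esub>, \<lambda>x\<in>G. \<zero>\<^bsub>A\<^esub>),
      ring.zero = (\<zero>\<^bsub>A\<^esub>, \<lambda>x\<in>G. \<zero>\<^bsub>A\<^esub>),
      ring.add = (\<lambda>(a, b) (a', b'). (a \<oplus>\<^bsub>A\<^esub> a', \<lambda>x\<in>G. b x \<oplus>\<^bsub>A\<^esub> b' x)),
      module.smult = (\<lambda>c (a, b). (c \<odot>\<^bsub>A\<^esub> a, \<lambda>x\<in>G. c \<odot>\<^bsub>A\<^esub> b x))\<rparr>"

lemma derivation_extension_simps [simp]:
  "(a, b) \<otimes>\<^bsub>derivation_extension K A G\<^esub> (a', b') =
     (a \<otimes>\<^bsub>A\<^esub> a', \<lambda>x\<in>G. a \<otimes>\<^bsub>A\<^esub> b' x \<oplus>\<^bsub>A\<^esub> a' \<otimes>\<^bsub>A\<^esub> b x)"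
  "\<one>\<^bsub>derivation_extension K A G\<^esub> = (\<one>\<^bsub>A\<^esub>, \<lambda>x\<in>G. \<zero>\<^bsub>A\<^esub>)"
  "\<zero>\<^bsub>derivation_extension K A G\<^esub> = (\<zero>\<^bsub>A\<^esub>, \<lambda>x\<in>G. \<zero>\<^bsub>A\<^esub>)"
  "(a, b) \<oplus>\<^bsub>derivation_extension K A G\<^esub> (a', b') = (a \<oplus>\<^bsub>A\<^esub> a', \<lambda>x\<in>G. b x \<oplus>\<^bsub>A\<^esub> b' x)"
  "c \<odot>\<^bsub>derivation_extension K A G\<^esub> (a, b) = (c \<odot>\<^bsub>A\<^esub> a, \<lambda>x\<in>G. c \<odot>\<^bsub>A\<^esub> b x)"
  by (simp_all add: derivation_extension_def)

context commutative_algebra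
begin

context
  fixes G :: "'a set"
  assumes G: "finite G" "G \<subseteq> carrier A"
begin

abbreviation ext_alg :: "('k, 'a \<times> ('a \<Rightarrow> 'a)) module" (\<open>\<E>\<close>) where
  "ext_alg \<equiv> derivation_extension K A G"

lemma extension_mem_iff:
  "(a, b) \<in> carrier \<E> \<longleftrightarrow> a \<in> carrier A \<and> b \<in> G \<rightarrow>\<^sub>E carrier A \<and>
     (\<forall>E\<in>derivations K A. E a = (\<Oplus>x\<in>G. b x \<otimes> E x))"
  by (simp add: derivation_extension_def)

lemma pairing_factors:
  assumes "b \<in> G \<rightarrow>\<^sub>E carrier A" "E \<in> derivations K A" "x \<in> G"
  shows "b x \<in> carrier A" "E x \<in> carrier A"
  using PiE_mem[OF assms(1,3)] der_closed[OF assms(2)] assms(3) G(2) by blast+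

lemma pairing_closed:
  assumes "b \<in> G \<rightarrow>\<^sub>E carrier A" "E \<in> derivations K A"
  shows "(\<lambda>x. b x \<otimes> E x) \<in> G \<rightarrow> carrier A"
  by (intro Pi_I A.m_closed pairing_factors[OF assms])

lemma pairing_restrict:
  assumes "f \<in> G \<rightarrow> carrier A" "E \<in> derivations K A"
  shows "(\<Oplus>x\<in>G. restrict f G x \<otimes> E x) = (\<Oplus>x\<in>G. f x \<otimes> E x)"
  using assms by (intro A.finsum_cong') (auto simp: Pi_iff subsetD[OF G(2)])

lemma pairing_add:
  assumes "b \<in> G \<rightarrow>\<^sub>E carrier A" "b' \<in> G \<rightarrow>\<^sub>E carrier A" "E \<in> derivations K A"
  shows "(\<Oplus>x\<in>G. (b x \<oplus> b' x) \<otimes> E x) = (\<Oplus>x\<in>G. b x \<otimes> E x) \<oplus> (\<Oplus>x\<in>G. b' x \<otimes> E x)"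
proof -
  have "(\<Oplus>x\<in>G. (b x \<oplus> b' x) \<otimes> E x) = (\<Oplus>x\<in>G. b x \<otimes> E x \<oplus> b' x \<otimes> E x)"
  proof (rule A.finsum_cong')
    show "(b x \<oplus> b' x) \<otimes> E x = b x \<otimes> E x \<oplus> b' x \<otimes> E x" if "x \<in> G" for x
      using that assms pairing_factors by (simp add: A.l_distr)
  qed (use pairing_closed assms in auto)
  then show ?thesis
    using A.finsum_addf[OF pairing_closed[OF assms(1,3)] pairing_closed[OF assms(2,3)]] by simp
qed

lemma pairing_mult:
  assumes "a \<in> carrier A" "b \<in> G \<rightarrow>\<^sub>E carrier A" "E \<in> derivations K A"
  shows "(\<Oplus>x\<in>G. (a \<otimes> b x) \<otimes> E x) = a \<otimes> (\<Oplus>x\<in>G. b x \<otimes> E x)"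
proof -
  have "(\<Oplus>x\<in>G. (a \<otimes> b x) \<otimes> E x) = (\<Oplus>x\<in>G. a \<otimes> (b x \<otimes> E x))"
  proof (rule A.finsum_cong')
    show "(a \<otimes> b x) \<otimes> E x = a \<otimes> (b x \<otimes> E x)" if "x \<in> G" for x
      using that assms pairing_factors by (simp add: A.m_assoc)
  qed (use pairing_closed assms in auto)
  then show ?thesis
    using A.finsum_rdistr[OF G(1) assms(1) pairing_closed[OF assms(2,3)]] by simp
qed

lemma extension_closed:
  "(\<one>, \<lambda>x\<in>G. \<zero>) \<in> carrier \<E>" "(\<zero>, \<lambda>x\<in>G. \<zero>) \<in> carrier \<E>"
  "\<lbrakk>p \<in> carrier \<E>; p' \<in> carrier \<E>\<rbrakk> \<Longrightarrow> p \<oplus>\<^bsub>\<E>\<^esub> p' \<in> carrier \<E>"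
  "\<lbrakk>p \<in> carrier \<E>; p' \<in> carrier \<E>\<rbrakk> \<Longrightarrow> p \<otimes>\<^bsub>\<E>\<^esub> p' \<in> carrier \<E>"
  "\<lbrakk>c \<in> carrier K; p \<in> carrier \<E>\<rbrakk> \<Longrightarrow> c \<odot>\<^bsub>\<E>\<^esub> p \<in> carrier \<E>"
proof -
  have zero: "(\<Oplus>x\<in>G. restrict (\<lambda>x. \<zero>) G x \<otimes> E x) = \<zero>" if "E \<in> derivations K A" for E
  proof -
    have "(\<Oplus>x\<in>G. restrict (\<lambda>x. \<zero>) G x \<otimes> E x) = (\<Oplus>x\<in>G. \<zero>)"
      using that G(2) by (intro A.finsum_cong') auto
    then show ?thesis by simp
  qed
  show "(\<one>, \<lambda>x\<in>G. \<zero>) \<in> carrier \<E>" "(\<zero>, \<lambda>x\<in>G. \<zero>) \<in> carrier \<E>"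
    using zero by (auto simp: extension_mem_iff simp del: restrict_apply)
  obtain a b a' b' where p: "p = (a, b)" "p' = (a', b')" by fastforce
  show "p \<oplus>\<^bsub>\<E>\<^esub> p' \<in> carrier \<E>" if "p \<in> carrier \<E>" "p' \<in> carrier \<E>"
  proof -
    have ab: "a \<in> carrier A" "b \<in> G \<rightarrow>\<^sub>E carrier A" "a' \<in> carrier A" "b' \<in> G \<rightarrow>\<^sub>E carrier A"
      and E: "\<And>E. E \<in> derivations K A \<Longrightarrow> E a = (\<Oplus>x\<in>G. b x \<otimes> E x)"
        "\<And>E. E \<in> derivations K A \<Longrightarrow> E a' = (\<Oplus>x\<in>G. b' x \<otimes> E x)"
      using that by (auto simp: p extension_mem_iff)
    have "(\<lambda>x. b x \<oplus> b' x) \<in> G \<rightarrow> carrier A" using ab by auto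
    then show ?thesis
      using ab by (auto simp: p extension_mem_iff pairing_restrict pairing_add der_add_arg E
          simp del: restrict_apply)
  qed
  show "p \<otimes>\<^bsub>\<E>\<^esub> p' \<in> carrier \<E>" if "p \<in> carrier \<E>" "p' \<in> carrier \<E>"
  proof -
    have ab: "a \<in> carrier A" "b \<in> G \<rightarrow>\<^sub>E carrier A" "a' \<in> carrier A" "b' \<in> G \<rightarrow>\<^sub>E carrier A"
      and E: "\<And>E. E \<in> derivations K A \<Longrightarrow> (\<Oplus>x\<in>G. b x \<otimes> E x) = E a"
        "\<And>E. E \<in> derivations K A \<Longrightarrow> (\<Oplus>x\<in>G. b' x \<otimes> E x) = E a'"
      using that by (auto simp: p extension_mem_iff)
    have cl: "(\<lambda>x\<in>G. a \<otimes> b' x) \<in> G \<rightarrow>\<^sub>E carrier A" "(\<lambda>x\<in>G. a' \<otimes> b x) \<in> G \<rightarrow>\<^sub>E carrier A"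
      using ab by auto
    have "(\<Oplus>x\<in>G. (\<lambda>x\<in>G. a \<otimes> b' x \<oplus> a' \<otimes> b x) x \<otimes> E x) = a \<otimes> E a' \<oplus> E a \<otimes> a'"
      if D: "E \<in> derivations K A" for E
    proof -
      have "(\<Oplus>x\<in>G. (\<lambda>x\<in>G. a \<otimes> b' x \<oplus> a' \<otimes> b x) x \<otimes> E x)
          = (\<Oplus>x\<in>G. (restrict (\<lambda>x. a \<otimes> b' x) G x \<oplus> restrict (\<lambda>x. a' \<otimes> b x) G x) \<otimes> E x)"
        using ab D by (intro A.finsum_cong') (auto simp: PiE_iff subsetD[OF G(2)])
      also have "\<dots> = (\<Oplus>x\<in>G. (a \<otimes> b' x) \<otimes> E x) \<oplus> (\<Oplus>x\<in>G. (a' \<otimes> b x) \<otimes> E x)"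
        using ab unfolding pairing_add[OF cl D]
        by (subst (1 2) pairing_restrict[OF _ D]) auto
      also have "\<dots> = a \<otimes> E a' \<oplus> E a \<otimes> a'"
        unfolding pairing_mult[OF ab(1,4) D] pairing_mult[OF ab(3,2) D] E[OF D]
        using ab D by (simp add: A.m_comm)
      finally show ?thesis .
    qed
    moreover have "(\<lambda>x\<in>G. a \<otimes> b' x \<oplus> a' \<otimes> b x) \<in> G \<rightarrow>\<^sub>E carrier A"
      using ab by (auto simp: PiE_iff)
    ultimately show ?thesis
      using ab by (auto simp: p extension_mem_iff der_mult_arg simp del: restrict_apply)
  qed
  show "c \<odot>\<^bsub>\<E>\<^esub> p \<in> carrier \<E>" if "c \<in> carrier K" "p \<in> carrier \<E>"
  proof -
    have ab: "a \<in> carrier A" "b \<in> G \<rightarrow>\<^sub>E carrier A" and c: "c \<odot> \<one> \<in> carrier A" "c \<in> carrier K"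
      and E: "\<And>E. E \<in> derivations K A \<Longrightarrow> (\<Oplus>x\<in>G. b x \<otimes> E x) = E a"
      using that by (auto simp: p extension_mem_iff)
    have "(\<Oplus>x\<in>G. (\<lambda>x\<in>G. c \<odot> b x) x \<otimes> E x) = c \<odot> E a" if D: "E \<in> derivations K A" for E
    proof -
      have "(\<Oplus>x\<in>G. (\<lambda>x\<in>G. c \<odot> b x) x \<otimes> E x) = (\<Oplus>x\<in>G. ((c \<odot> \<one>) \<otimes> b x) \<otimes> E x)"
        using ab c D
        by (intro A.finsum_cong') (auto simp: smult_assoc2 PiE_iff subsetD[OF G(2)])
      also have "\<dots> = c \<odot> E a"
        unfolding pairing_mult[OF c(1) ab(2) D] E[OF D]
        using ab c D by (simp add: smult_assoc2)
      finally show ?thesis .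
    qed
    then show ?thesis
      using ab c by (auto simp: p extension_mem_iff der_smult_arg simp del: restrict_apply)
  qed
qed

lemma extension_is_algebra: "algebra K \<E>"
proof -
  note [simp] = extension_closed
  have mem: "\<exists>a b. p = (a, b) \<and> a \<in> carrier A \<and> b \<in> extensional G \<and> (\<forall>x\<in>G. b x \<in> carrier A)"
    if "p \<in> carrier \<E>" for p
    using that by (cases p) (auto simp: extension_mem_iff PiE_def)
  have neg: "\<exists>p'\<in>carrier \<E>. p' \<oplus>\<^bsub>\<E>\<^esub> p = \<zero>\<^bsub>\<E>\<^esub>" if p: "p \<in> carrier \<E>" for p
  proof
    show "(\<ominus>\<^bsub>K\<^esub> \<one>\<^bsub>K\<^esub>) \<odot>\<^bsub>\<E>\<^esub> p \<in> carrier \<E>" using p by simp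
    show "(\<ominus>\<^bsub>K\<^esub> \<one>\<^bsub>K\<^esub>) \<odot>\<^bsub>\<E>\<^esub> p \<oplus>\<^bsub>\<E>\<^esub> p = \<zero>\<^bsub>\<E>\<^esub>"
      using mem[OF p] by (auto simp: smult_l_minus A.l_neg intro!: restrict_ext)
  qed
  have "cring \<E>"
  proof (rule cringI)
    show "abelian_group \<E>"
    proof (rule abelian_groupI)
      fix p q r assume pqr: "p \<in> carrier \<E>" "q \<in> carrier \<E>" "r \<in> carrier \<E>"
      show "p \<oplus>\<^bsub>\<E>\<^esub> q \<oplus>\<^bsub>\<E>\<^esub> r = p \<oplus>\<^bsub>\<E>\<^esub> (q \<oplus>\<^bsub>\<E>\<^esub> r)"
        using pqr[THEN mem] by (auto simp: A.a_assoc intro!: restrict_ext)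
    next
      fix p q assume pq: "p \<in> carrier \<E>" "q \<in> carrier \<E>"
      show "p \<oplus>\<^bsub>\<E>\<^esub> q = q \<oplus>\<^bsub>\<E>\<^esub> p"
        using pq[THEN mem] by (auto simp: A.a_comm intro!: restrict_ext)
    next
      fix p assume p: "p \<in> carrier \<E>"
      show "\<zero>\<^bsub>\<E>\<^esub> \<oplus>\<^bsub>\<E>\<^esub> p = p"
        using mem[OF p] by (auto intro!: extensionalityI[where A = G])
    qed (use neg in auto)
    show "comm_monoid \<E>"
    proof (rule comm_monoidI)
      fix p q r assume pqr: "p \<in> carrier \<E>" "q \<in> carrier \<E>" "r \<in> carrier \<E>"
      show "p \<otimes>\<^bsub>\<E>\<^esub> q \<otimes>\<^bsub>\<E>\<^esub> r = p \<otimes>\<^bsub>\<E>\<^esub> (q \<otimes>\<^bsub>\<E>\<^esub> r)"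
        using pqr[THEN mem]
        by (auto simp: A.r_distr A.m_ac A.a_ac intro!: restrict_ext)
    next
      fix p q assume pq: "p \<in> carrier \<E>" "q \<in> carrier \<E>"
      show "p \<otimes>\<^bsub>\<E>\<^esub> q = q \<otimes>\<^bsub>\<E>\<^esub> p"
        using pq[THEN mem] by (auto simp: A.m_comm A.a_comm intro!: restrict_ext)
    next
      fix p assume p: "p \<in> carrier \<E>"
      show "\<one>\<^bsub>\<E>\<^esub> \<otimes>\<^bsub>\<E>\<^esub> p = p"
        using mem[OF p] by (auto intro!: extensionalityI[where A = G])
    qed auto
    fix p q r assume pqr: "p \<in> carrier \<E>" "q \<in> carrier \<E>" "r \<in> carrier \<E>"
    show "(p \<oplus>\<^bsub>\<E>\<^esub> q) \<otimes>\<^bsub>\<E>\<^esub> r = p \<otimes>\<^bsub>\<E>\<^esub> r \<oplus>\<^bsub>\<E>\<^esub> q \<otimes>\<^bsub>\<E>\<^esub> r"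
      using pqr[THEN mem] by (auto simp: A.l_distr A.r_distr A.a_ac intro!: restrict_ext)
  qed
  then show ?thesis
  proof (rule algebraI[OF R_cring], goal_cases)
    case (2 c d p)
    then show ?case using mem[of p] by (auto simp: smult_l_distr intro!: restrict_ext)
  next
    case (3 c p q)
    then show ?case using mem[of p] mem[of q] by (auto simp: smult_r_distr intro!: restrict_ext)
  next
    case (4 c d p)
    then show ?case using mem[of p] by (auto simp: smult_assoc1 intro!: restrict_ext)
  next
    case (5 p)
    then show ?case using mem[of p] by (auto intro!: extensionalityI[where A = G])
  next
    case (6 c p q)
    have "a \<otimes> (c \<odot> b) = c \<odot> (a \<otimes> b)" if "a \<in> carrier A" "b \<in> carrier A" for a b
      using smult_assoc2[of c b a] 6(1) that by (simp add: A.m_comm)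
    then show ?case
      using 6 mem[of p] mem[of q] by (auto simp: smult_assoc2 smult_r_distr intro!: restrict_ext)
  qed simp
qed

text \<open>
  The elements of \<open>A\<close> that lift form a subalgebra, and a generator \<open>y\<close> lifts with the unit vector at
  \<open>y\<close> as second component.
\<close>

lemma extension_projection:
  assumes generates: "unital_subalgebra K A hull G = carrier A"
  shows "fst \<in> algebra_hom K \<E> A" "fst ` carrier \<E> = carrier A"
proof -
  show hom: "fst \<in> algebra_hom K \<E> A"
    by (rule algebra_homI) (auto simp: extension_mem_iff split_paired_all)
  have "\<exists>b. (a, b) \<in> carrier \<E>" if "a \<in> carrier A" for a
    using generates that
  proof (induction rule: generated_induct)
    case carrier
    show ?case by (rule G(2))
  next
    case (generator y)
    let ?b = "\<lambda>x\<in>G. if x = y then \<one> else \<zero>"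
    have "E y = (\<Oplus>x\<in>G. ?b x \<otimes> E x)" if E: "E \<in> derivations K A" for E
    proof -
      have "(\<Oplus>x\<in>G. ?b x \<otimes> E x) = (\<Oplus>x\<in>G. if y = x then E x else \<zero>)"
        using E G(2) by (intro A.finsum_cong') auto
      also have "\<dots> = E y"
        using A.finsum_singleton[OF generator G(1), of E] E subsetD[OF G(2)] by (simp add: Pi_iff)
      finally show ?thesis by simp
    qed
    then have "(y, ?b) \<in> carrier \<E>"
      using generator G(2) by (auto simp: extension_mem_iff simp del: restrict_apply)
    then show ?case by blast
  next
    case one
    show ?case using extension_closed(1) by blast
  next
    case (add a a')
    then obtain b b' where "(a, b) \<in> carrier \<E>" "(a', b') \<in> carrier \<E>" by blast
    from extension_closed(3)[OF this] show ?case by auto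
  next
    case (mult a a')
    then obtain b b' where "(a, b) \<in> carrier \<E>" "(a', b') \<in> carrier \<E>" by blast
    from extension_closed(4)[OF this] show ?case by auto
  next
    case (smult c a)
    then obtain b where "(a, b) \<in> carrier \<E>" by blast
    from extension_closed(5)[OF smult(1) this] show ?case by auto
  qed
  note lift = this
  show "fst ` carrier \<E> = carrier A"
  proof
    show "fst ` carrier \<E> \<subseteq> carrier A"
      by (rule image_subsetI) (rule algebra_homD(1)[OF hom])
    show "carrier A \<subseteq> fst ` carrier \<E>"
    proof
      fix a assume "a \<in> carrier A"
      from lift[OF this] obtain b where "(a, b) \<in> carrier \<E>" ..
      from imageI[OF this, of fst] show "a \<in> fst ` carrier \<E>" by simp
    qed
  qed
qed

text \<open>
  Multiplicativity of \<open>s\<close> in the second component is the Leibniz rule, and membership of \<open>s a\<close> in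
  the extension is the dual basis property.
\<close>

lemma section_gives_derivation_basis:
  assumes generates: "unital_subalgebra K A hull G = carrier A"
    and s: "s \<in> algebra_hom K A \<E>" "\<And>a. a \<in> carrier A \<Longrightarrow> fst (s a) = a"
  shows "derivation_basis A K G (\<lambda>x. \<lambda>a\<in>carrier A. snd (s a) x)"
proof -
  note hom = algebra_homD[OF s(1)]
  define b where "b a = snd (s a)" for a
  have s_eq: "s a = (a, b a)" if "a \<in> carrier A" for a
    using s(2)[OF that] by (simp add: b_def prod_eq_iff)
  have mem: "(a, b a) \<in> carrier \<E>" if "a \<in> carrier A" for a
    using hom(1)[OF that] s_eq[OF that] by simp
  have cl: "b a x \<in> carrier A" if "a \<in> carrier A" "x \<in> G" for a x
    using mem[OF that(1)] that(2) by (auto simp: extension_mem_iff)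
  have "b (a \<oplus> a') x = b a x \<oplus> b a' x" "b (a \<otimes> a') x = a \<otimes> b a' x \<oplus> b a x \<otimes> a'"
    if "a \<in> carrier A" "a' \<in> carrier A" "x \<in> G" for a a' x
    using hom(2,3)[OF that(1,2)] that cl by (auto simp: s_eq A.m_comm)
  moreover have "b (c \<odot> a) x = c \<odot> b a x" if "c \<in> carrier K" "a \<in> carrier A" "x \<in> G" for c a x
    using hom(5)[OF that(1,2)] that by (auto simp: s_eq)
  ultimately have "(\<lambda>a\<in>carrier A. b a x) \<in> derivations K A" if "x \<in> G" for x
    using that cl by (auto simp: derivations_def)
  moreover have "E a = (\<Oplus>x\<in>G. (\<lambda>a\<in>carrier A. b a x) a \<otimes> E x)"
    if "E \<in> derivations K A" "a \<in> carrier A" for E a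
    using mem[OF that(2)] that by (simp add: extension_mem_iff)
  ultimately show ?thesis
    unfolding b_def
    by unfold_locales (use G generates in auto)
qed

end

lemma smooth_derivation_basis:
  assumes "smooth_algebra K A"
  shows "\<exists>G B. derivation_basis A K G B"
proof -
  obtain G where G: "finite G" "G \<subseteq> carrier A" and generates: "unital_subalgebra K A hull G = carrier A"
    using assms by (auto simp: smooth_algebra_def finite_type_algebra_def)
  let ?E = "derivation_extension K A G"
  obtain \<iota> :: "'a \<times> ('a \<Rightarrow> 'a) \<Rightarrow> (nat multiset \<Rightarrow> 'k) set"
    where "inj_on \<iota> (carrier A \<times> (G \<rightarrow>\<^sub>E carrier A))"
    using embedding_into_coefficient_functions[OF G generates] by blast
  moreover have "carrier ?E \<subseteq> carrier A \<times> (G \<rightarrow>\<^sub>E carrier A)"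
    by (auto simp: extension_mem_iff[OF G])
  ultimately have inj: "inj_on \<iota> (carrier ?E)"
    by (rule inj_on_subset)
  have square_zero: "p \<otimes>\<^bsub>?E\<^esub> q = \<zero>\<^bsub>?E\<^esub>"
    if "p \<in> carrier ?E" "q \<in> carrier ?E" "fst p = \<zero>" "fst q = \<zero>" for p q
    using that by (cases p; cases q) (auto simp: extension_mem_iff[OF G] PiE_iff intro!: restrict_ext)
  have "\<exists>s\<in>algebra_hom K A ?E. \<forall>a\<in>carrier A. fst (s a) = a"
    by (rule section_of_embedded_square_zero_extension[OF _ algebra_axiom extension_is_algebra[OF G]
          inj extension_projection[OF G generates] square_zero])
      (use assms in \<open>simp add: smooth_algebra_def\<close>)
  then show ?thesis
    using section_gives_derivation_basis[OF G generates] by blast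
qed

end

section \<open>Finite generation\<close>

lemma (in field) half_exists:
  assumes "ring_characteristic R \<noteq> 2"
  shows "\<exists>h\<in>carrier R. h \<otimes> (\<one> \<oplus> \<one>) = \<one>"
proof -
  have "\<one> \<oplus> \<one> \<noteq> \<zero>"
  proof
    assume "\<one> \<oplus> \<one> = \<zero>"
    then have "add_pow R (2 :: nat) \<one> = \<zero>"
      by (simp add: numeral_2_eq_2)
    then have "ring_characteristic R dvd 2"
      by (simp only: ring_characteristic_iff)
    then have "ring_characteristic R = 1"
      using assms by (metis prime_nat_iff two_is_prime_nat)
    then have "add_pow R (1 :: nat) \<one> = \<zero>"
      by (simp only: ring_characteristic_iff dvd_refl)
    then show False by simp
  qed
  then have "\<one> \<oplus> \<one> \<in> Units R"
    by (simp add: field_Units)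
  then show ?thesis
    using Units_l_inv Units_inv_closed by blast
qed

theorem theoremA1:
  fixes K :: "('k, 'n) ring_scheme" and A :: "('k, 'a, 'm) module_scheme"
  assumes "field K" and "ring_characteristic K \<noteq> 2"
    and "algebra K A" and "finite_type_algebra K A" and "smooth_algebra K A"
  shows "finitely_generated_lie_algebra K (Der K A)"
proof -
  interpret K: field K by fact
  interpret commutative_algebra A K
    using assms(3) algebra.M_cring by (simp add: commutative_algebra_def)
  obtain h where "h \<in> carrier K" "h \<otimes>\<^bsub>K\<^esub> (\<one>\<^bsub>K\<^esub> \<oplus>\<^bsub>K\<^esub> \<one>\<^bsub>K\<^esub>) = \<one>\<^bsub>K\<^esub>"
    using K.half_exists[OF assms(2)] by blast
  moreover obtain G B where "derivation_basis A K G B"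
    using smooth_derivation_basis[OF assms(5)] by blast
  ultimately show ?thesis
    by (intro derivation_basis.derivations_finitely_generated)
qed

end
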